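(* Let $a>0$, $b<0$, $b_X\neq 0$ and $U_{\rm e}$ be real constants and let $U(t)$, $t\ge 0$, be a (measured) real-valued input. Consider the plant, for $t\ge 0$ and $x\in[0,1]$, $$u_t(x,t)=b\,u_x(x,t)+b_X X(t),\qquad u(0,t)=2U_{\rm e}-U(t),$$ $$\dot X(t)=-aX(t)+V(t),\qquad \dot V(t)=0,$$ and the observer $$\hat u_t(x,t)=b\,\hat u_x(x,t)+b_X\hat X(t)+p(x)\big(u(1,t)-\hat u(1,t)\big),\qquad \hat u(0,t)=-U(t)+2U_{\rm e},$$ $$\dot{\hat X}(t)=-a\hat X(t)+\hat V(t)+L_1\big(u(1,t)-\hat u(1,t)\big),\qquad \dot{\hat V}(t)=L_2\big(u(1,t)-\hat u(1,t)\big),$$ where $$p(x)=L_1\gamma_1(x)+L_2\gamma_2(x),\qquad \gamma_1(x)=\frac{b_X}{a}\left(e^{-\frac{a}{b}x}-1\right),\qquad \gamma_2(x)=-\frac{b_X}{ba}x+\frac{b_X}{a^2}\left(1-e^{-\frac{a}{b}x}\right).$$ Let $L_1,L_2\in\mathbb R$ be chosen such that the matrix $A-\begin{bmatrix}L_1\\ L_2\end{bmatrix}C$ is Hurwitz, where $$A=\begin{bmatrix}-a&1\\0&0\end{bmatrix},\qquad C=\begin{bmatrix}\gamma_1(1)&\gamma_2(1)\end{bmatrix}.$$ Then for any $u(\cdot,0),\hat u(\cdot,0)\in L_2(0,1)$ and $X(0),\hat X(0),V(0),\hat V(0)\in\mathbb R$, there exist positive constants $\kappa$ and $\lambda$ such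 that for all $t\ge 0$ $$\Omega(t)\le \kappa\,\Omega(0)\,e^{-\lambda t},$$ where $$\Omega(t)=\int_0^1\big(u(x,t)-\hat u(x,t)\big)^2dx+\big(X(t)-\hat X(t)\big)^2+\big(V(t)-\hat V(t)\big)^2.$$
   Context: A real square matrix is Hurwitz if all its eigenvalues have strictly negative real part. Subscripts $t,x$ denote partial derivatives and dots denote time derivatives. Solutions of the first-order hyperbolic (transport) equations with $L_2(0,1)$ initial data are understood in the usual weak/mild sense; since $b<0$, transport is from $x=0$ to $x=1$. *)

theory Defs
  imports "HOL-Analysis.Analysis" "Jordan_Normal_Form.Char_Poly"
begin

definition hurwitz :: "real mat \<Rightarrow> bool" where
  "hurwitz M \<longleftrightarrow> square_mat M \<and>
     (\<forall>k::complex. eigenvalue (map_mat complex_of_real M) k \<longrightarrow> Re k < 0)"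

(* Elements of L2(0,1) are represented by Borel functions on the closed interval; the end points
   form a null set. *)
definition L2_unit :: "(real \<Rightarrow> real) \<Rightarrow> bool" where
  "L2_unit f \<longleftrightarrow> set_borel_measurable borel {0..1} f \<and>
     set_integrable lborel {0..1} (\<lambda>x. (f x)\<^sup>2)"

(* Functions w are written w x t.  The values w 0 t and w 1 t are the boundary traces of w.  On the
   null sets x = 0 and x = 1 they are not determined by the interior values as such: the weak
   equation below is what links them to the interior. *)

definition L2_loc_time :: "(real \<Rightarrow> real) \<Rightarrow> bool" where
  "L2_loc_time g \<longleftrightarrow> (\<forall>T\<ge>0. set_integrable lborel {0..T} (\<lambda>t. (g t)\<^sup>2))"

(* w lies in C([0,\<infinity>); L2(0,1)) and has boundary traces that are locally square integrable
   in time. *)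
definition transport_regular :: "(real \<Rightarrow> real \<Rightarrow> real) \<Rightarrow> bool" where
  "transport_regular w \<longleftrightarrow>
     set_borel_measurable borel ({0..1} \<times> {0..}) (\<lambda>(x, t). w x t) \<and>
     (\<forall>t\<ge>0. L2_unit (\<lambda>x. w x t)) \<and>
     (\<forall>t\<ge>0. ((\<lambda>s. LBINT x:{0..1}. (w x s - w x t)\<^sup>2) \<longlongrightarrow> 0) (at t within {0..})) \<and>
     L2_loc_time (w 0) \<and> L2_loc_time (w 1)"

(* \<phi> is C1 on the plane, with partial derivatives \<phi>x and \<phi>t. *)
definition C1_test :: "(real \<Rightarrow> real \<Rightarrow> real) \<Rightarrow> (real \<Rightarrow> real \<Rightarrow> real) \<Rightarrow> (real \<Rightarrow> real \<Rightarrow> real) \<Rightarrow> bool" where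
  "C1_test \<phi> \<phi>x \<phi>t \<longleftrightarrow>
     (\<forall>x t. ((\<lambda>y. \<phi> y t) has_real_derivative \<phi>x x t) (at x)) \<and>
     (\<forall>x t. (\<phi> x has_real_derivative \<phi>t x t) (at t)) \<and>
     continuous_on UNIV (\<lambda>(x, t). \<phi>x x t) \<and>
     continuous_on UNIV (\<lambda>(x, t). \<phi>t x t)"

(* Weak form of w_t = b w_x + f on (0,1) x (0,\<infinity>): multiply by \<phi>, integrate over
   (0,1) x (0,T) and integrate by parts.  As \<phi> need not vanish at x = 0 or x = 1, the equation
   also determines, up to null sets, the traces w 0 and w 1 from the interior values. *)
definition weak_transport ::
    "real \<Rightarrow> (real \<Rightarrow> real \<Rightarrow> real) \<Rightarrow> (real \<Rightarrow> real \<Rightarrow> real) \<Rightarrow> bool" where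
  "weak_transport b f w \<longleftrightarrow> transport_regular w \<and>
     (\<forall>T\<ge>0. \<forall>\<phi> \<phi>x \<phi>t. C1_test \<phi> \<phi>x \<phi>t \<longrightarrow>
        (LBINT x:{0..1}. w x T * \<phi> x T) - (LBINT x:{0..1}. w x 0 * \<phi> x 0) =
        (LBINT t:{0..T}. (LBINT x:{0..1}. w x t * (\<phi>t x t - b * \<phi>x x t) + f x t * \<phi> x t)) +
        b * (LBINT t:{0..T}. w 1 t * \<phi> 1 t - w 0 t * \<phi> 0 t))"

(* z' = F for almost all t >= 0 with z locally absolutely continuous (Caratheodory solution); F need
   only be locally integrable, as is the case for the output injection below. *)
definition caratheodory_deriv :: "(real \<Rightarrow> real) \<Rightarrow> (real \<Rightarrow> real) \<Rightarrow> bool" where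
  "caratheodory_deriv z F \<longleftrightarrow>
     (\<forall>t\<ge>0. set_integrable lborel {0..t} F \<and> z t = z 0 + (LBINT s:{0..t}. F s))"

definition \<gamma>\<^sub>1 :: "real \<Rightarrow> real \<Rightarrow> real \<Rightarrow> real \<Rightarrow> real" where
  "\<gamma>\<^sub>1 a b bX x = bX / a * (exp (- (a / b) * x) - 1)"

definition \<gamma>\<^sub>2 :: "real \<Rightarrow> real \<Rightarrow> real \<Rightarrow> real \<Rightarrow> real" where
  "\<gamma>\<^sub>2 a b bX x = - (bX / (b * a)) * x + bX / a\<^sup>2 * (1 - exp (- (a / b) * x))"

definition inj_gain :: "real \<Rightarrow> real \<Rightarrow> real \<Rightarrow> real \<Rightarrow> real \<Rightarrow> real \<Rightarrow> real" where
  "inj_gain a b bX L1 L2 x = L1 * \<gamma>\<^sub>1 a b bX x + L2 * \<gamma>\<^sub>2 a b bX x"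

definition A_mat :: "real \<Rightarrow> real mat" where
  "A_mat a = mat_of_rows_list 2 [[- a, 1], [0, 0]]"

definition C_mat :: "real \<Rightarrow> real \<Rightarrow> real \<Rightarrow> real mat" where
  "C_mat a b bX = mat_of_rows_list 2 [[\<gamma>\<^sub>1 a b bX 1, \<gamma>\<^sub>2 a b bX 1]]"

definition L_mat :: "real \<Rightarrow> real \<Rightarrow> real mat" where
  "L_mat L1 L2 = mat_of_rows_list 1 [[L1], [L2]]"

definition plant_solution ::
    "real \<Rightarrow> real \<Rightarrow> real \<Rightarrow> real \<Rightarrow> (real \<Rightarrow> real) \<Rightarrow>
     (real \<Rightarrow> real \<Rightarrow> real) \<Rightarrow> (real \<Rightarrow> real) \<Rightarrow> (real \<Rightarrow> real) \<Rightarrow> bool" where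
  "plant_solution a b bX Ue U u X V \<longleftrightarrow>
     weak_transport b (\<lambda>x t. bX * X t) u \<and>
     (AE t in lborel. t \<ge> 0 \<longrightarrow> u 0 t = 2 * Ue - U t) \<and>
     (\<forall>t\<ge>0. (X has_real_derivative (- a * X t + V t)) (at t within {0..})) \<and>
     (\<forall>t\<ge>0. (V has_real_derivative 0) (at t within {0..}))"

(* The observer for the plant output t \<mapsto> u 1 t. *)
definition observer_solution ::
    "real \<Rightarrow> real \<Rightarrow> real \<Rightarrow> real \<Rightarrow> real \<Rightarrow> real \<Rightarrow> (real \<Rightarrow> real) \<Rightarrow> (real \<Rightarrow> real \<Rightarrow> real) \<Rightarrow>
     (real \<Rightarrow> real \<Rightarrow> real) \<Rightarrow> (real \<Rightarrow> real) \<Rightarrow> (real \<Rightarrow> real) \<Rightarrow> bool" where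
  "observer_solution a b bX Ue L1 L2 U u uh Xh Vh \<longleftrightarrow>
     weak_transport b (\<lambda>x t. bX * Xh t + inj_gain a b bX L1 L2 x * (u 1 t - uh 1 t)) uh \<and>
     (AE t in lborel. t \<ge> 0 \<longrightarrow> uh 0 t = - U t + 2 * Ue) \<and>
     caratheodory_deriv Xh (\<lambda>t. - a * Xh t + Vh t + L1 * (u 1 t - uh 1 t)) \<and>
     caratheodory_deriv Vh (\<lambda>t. L2 * (u 1 t - uh 1 t))"

definition initial_data ::
    "(real \<Rightarrow> real) \<Rightarrow> real \<Rightarrow> real \<Rightarrow>
     (real \<Rightarrow> real \<Rightarrow> real) \<Rightarrow> (real \<Rightarrow> real) \<Rightarrow> (real \<Rightarrow> real) \<Rightarrow> bool" where
  "initial_data w0 x0 v0 w X V \<longleftrightarrow>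
     (AE x in lborel. x \<in> {0..1} \<longrightarrow> w x 0 = w0 x) \<and> X 0 = x0 \<and> V 0 = v0"

definition \<Omega> ::
    "(real \<Rightarrow> real \<Rightarrow> real) \<Rightarrow> (real \<Rightarrow> real) \<Rightarrow> (real \<Rightarrow> real) \<Rightarrow>
     (real \<Rightarrow> real \<Rightarrow> real) \<Rightarrow> (real \<Rightarrow> real) \<Rightarrow> (real \<Rightarrow> real) \<Rightarrow> real \<Rightarrow> real" where
  "\<Omega> u X V uh Xh Vh t =
     (LBINT x:{0..1}. (u x t - uh x t)\<^sup>2) + (X t - Xh t)\<^sup>2 + (V t - Vh t)\<^sup>2"

end

theory Submission
  imports Defs
begin

text \<open>Write \<open>w = u - uh\<close>, \<open>Xe = X - Xh\<close>, \<open>Ve = V - Vh\<close> for the observer errors and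
  \<open>y(t) = w(1,t)\<close> for the output error.  The input and \<open>U\<^sub>e\<close> cancel, so that \<open>w(0,t) = 0\<close>.  The functions
  \<open>\<gamma>\<^sub>1\<close>, \<open>\<gamma>\<^sub>2\<close> solve \<open>b \<gamma>\<^sub>1' = - a \<gamma>\<^sub>1 - b\<^sub>X\<close>, \<open>b \<gamma>\<^sub>2' = \<gamma>\<^sub>1\<close> and vanish at \<open>0\<close>, and \<open>p = L\<^sub>1 \<gamma>\<^sub>1 + L\<^sub>2 \<gamma>\<^sub>2\<close>;
  this is exactly what makes the backstepping variable
  \<open>z(x,t) = w(x,t) - \<gamma>\<^sub>1(x) Xe(t) - \<gamma>\<^sub>2(x) Ve(t)\<close> a solution of the undisturbed transport equation
  \<open>z\<^sub>t = b z\<^sub>x\<close>, \<open>z(0,t) = 0\<close>.  With \<open>\<zeta>(t) = z(1,t)\<close> the output error is \<open>y = \<zeta> + C \<xi>\<close> for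
  \<open>\<xi> = (Xe, Ve)\<close>, hence \<open>\<xi>' = (A - L C) \<xi> - L \<zeta>\<close>: the error system is a cascade of a transport
  equation, which is empty after the travel time \<open>\<tau> = 1 / \<bar>b\<bar>\<close>, and of a stable planar system driven by its
  outflow \<open>\<zeta>\<close>.

  The energy balance \<open>\<integral> z(x,T)\<^sup>2 dx + \<bar>b\<bar> \<integral>\<^sub>0\<^sup>T \<zeta>\<^sup>2 = \<integral> z(x,0)\<^sup>2 dx\<close> (\<open>transport_energy\<close>) controls the input,
  which stops at time \<open>\<tau>\<close>; variation of constants then gives exponential decay of \<open>\<xi>\<close>
  (\<open>forced_system_decay\<close>), and \<open>w\<close> is recovered from \<open>z\<close> and \<open>\<xi>\<close> at the price of constants.

  Solutions are only weak, so no step may differentiate \<open>w\<close>.  The weak equation is used solely with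
  the test functions \<open>\<phi>(x,t) = g (x + b t)\<close>, which are constant along characteristics; for these the
  term containing \<open>w\<close> itself disappears and a relation between the profile at time \<open>T\<close>, the initial
  profile, the source and the boundary traces remains (\<open>weak_transport_along_characteristics\<close>).  The terms
  \<open>\<gamma>\<^sub>i \<xi>\<^sub>i\<close> enter through the moments \<open>\<integral> \<gamma>\<^sub>i(x) g (x + b t) dx\<close>, which are \<open>C\<^sup>1\<close> in time, and the product rule for
  a \<open>C\<^sup>1\<close> function and a Caratheodory solution (\<open>backstepping_identity\<close>).  The resulting identity for \<open>z\<close> holds
  for all \<open>C\<^sup>1\<close> functions \<open>g\<close>, so by the fundamental lemma of the calculus of variations it is the
  almost everywhere statement that the initial profile is the disjoint union of the translated profile
  at time \<open>T\<close> and the outflow up to \<open>T\<close>.\<close>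

section \<open>Square integrable functions on an interval\<close>

lemma square_integrable_imp_integrable:
  fixes f :: "real \<Rightarrow> real"
  assumes m: "set_borel_measurable borel {p..q} f" and i: "set_integrable lborel {p..q} (\<lambda>x. (f x)\<^sup>2)"
  shows "set_integrable lborel {p..q} f"
proof -
  have "set_integrable lborel {p..q} (\<lambda>x. 1 + (f x)\<^sup>2)"
    using borel_integrable_atLeastAtMost'[of p q "\<lambda>_. 1::real"] i by (intro set_integral_add) auto
  then show ?thesis
  proof (rule set_integrable_bound)
    show "set_borel_measurable lborel {p..q} f" using m by (simp add: set_borel_measurable_def)
    have "\<bar>y\<bar> \<le> 1 + y\<^sup>2" for y :: real
      using zero_le_power2[of "\<bar>y\<bar> - 1"] by (auto simp: power2_eq_square algebra_simps abs_if split: if_splits)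
    then show "AE x in lborel. x \<in> {p..q} \<longrightarrow> norm (f x) \<le> norm (1 + (f x)\<^sup>2)" by auto
  qed
qed

lemma set_integrable_mult_continuous:
  fixes f g :: "real \<Rightarrow> real"
  assumes i: "set_integrable lborel {p..q} f" and g: "continuous_on {p..q} g"
  shows "set_integrable lborel {p..q} (\<lambda>x. f x * g x)"
proof -
  obtain B where "\<forall>x\<in>{p..q}. \<bar>g x\<bar> \<le> B"
    using compact_imp_bounded[OF compact_continuous_image[OF g compact_Icc]]
    by (auto simp: bounded_iff)
  then have B: "\<bar>g x\<bar> \<le> B" if "x \<in> {p..q}" for x using that by blast
  have "set_integrable lborel {p..q} (\<lambda>x. B * f x)" using i by simp
  then show ?thesis
  proof (rule set_integrable_bound)
    have "(\<lambda>x. (indicator {p..q} x *\<^sub>R f x) * (indicator {p..q} x *\<^sub>R g x)) \<in> borel_measurable borel"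
      using i borel_measurable_continuous_on_indicator[OF _ g]
      by (intro borel_measurable_times) (auto simp: set_integrable_def)
    moreover have "(\<lambda>x. (indicator {p..q} x *\<^sub>R f x) * (indicator {p..q} x *\<^sub>R g x)) = 
        (\<lambda>x. indicator {p..q} x *\<^sub>R (f x * g x))" by (auto simp: indicator_def)
    ultimately show "set_borel_measurable lborel {p..q} (\<lambda>x. f x * g x)"
      by (simp add: set_borel_measurable_def)
    show "AE x in lborel. x \<in> {p..q} \<longrightarrow> norm (f x * g x) \<le> norm (B * f x)"
      using B by (intro AE_I2) (auto simp: abs_mult mult.commute[of "\<bar>f _\<bar>"] intro!: mult_right_mono order_trans[OF B])
  qed
qed

definition L2_Icc :: "real \<Rightarrow> real \<Rightarrow> (real \<Rightarrow> real) \<Rightarrow> bool" where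
  "L2_Icc p q f \<longleftrightarrow> set_borel_measurable borel {p..q} f \<and> set_integrable lborel {p..q} (\<lambda>x. (f x)\<^sup>2)"

lemma L2_unit_iff: "L2_unit f \<longleftrightarrow> L2_Icc 0 1 f"
  by (simp add: L2_unit_def L2_Icc_def)

lemma L2_Icc_integrable: "L2_Icc p q f \<Longrightarrow> set_integrable lborel {p..q} f"
  unfolding L2_Icc_def by (blast intro: square_integrable_imp_integrable)

lemma L2_Icc_continuous:
  assumes "continuous_on {p..q} f"
  shows "L2_Icc p q f"
  unfolding L2_Icc_def set_borel_measurable_def
  by (intro conjI borel_measurable_continuous_on_indicator borel_integrable_atLeastAtMost' continuous_intros assms) auto

lemma square_diff_le: "(x - y)\<^sup>2 \<le> 2 * x\<^sup>2 + 2 * (y::real)\<^sup>2"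
  using zero_le_power2[of "x + y"] by (simp add: power2_eq_square algebra_simps)

lemma L2_Icc_diff:
  assumes f: "L2_Icc p q f" and g: "L2_Icc p q g"
  shows "L2_Icc p q (\<lambda>x. f x - g x)"
proof -
  have m: "set_borel_measurable borel {p..q} (\<lambda>x. f x - g x)"
    using f g borel_measurable_diff[of "\<lambda>x. indicator {p..q} x *\<^sub>R f x" borel "\<lambda>x. indicator {p..q} x *\<^sub>R g x"]
    by (simp add: L2_Icc_def set_borel_measurable_def right_diff_distrib)
  have "set_integrable lborel {p..q} (\<lambda>x. 2 * (f x)\<^sup>2 + 2 * (g x)\<^sup>2)"
    using f g by (intro set_integral_add set_integrable_mult_right) (auto simp: L2_Icc_def)
  then have "set_integrable lborel {p..q} (\<lambda>x. (f x - g x)\<^sup>2)"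
  proof (rule set_integrable_bound)
    have "(\<lambda>x. (indicator {p..q} x *\<^sub>R (f x - g x))\<^sup>2) \<in> borel_measurable borel"
      using m by (intro borel_measurable_power) (simp add: set_borel_measurable_def)
    moreover have "(\<lambda>x. (indicator {p..q} x *\<^sub>R (f x - g x))\<^sup>2) = (\<lambda>x. indicator {p..q} x *\<^sub>R (f x - g x)\<^sup>2)"
      by (auto simp: indicator_def)
    ultimately show "set_borel_measurable lborel {p..q} (\<lambda>x. (f x - g x)\<^sup>2)"
      by (simp add: set_borel_measurable_def)
    show "AE x in lborel. x \<in> {p..q} \<longrightarrow> norm ((f x - g x)\<^sup>2) \<le> norm (2 * (f x)\<^sup>2 + 2 * (g x)\<^sup>2)"
      using square_diff_le by (intro AE_I2) auto
  qed
  with m show ?thesis by (simp add: L2_Icc_def)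
qed

section \<open>The fundamental lemma of the calculus of variations\<close>

text \<open>The positive and the negative part of \<open>f\<close> are densities of finite measures that agree on the
  generating half-lines, hence are equal measures.\<close>

lemma AE_zero_if_half_line_integrals_zero:
  fixes f :: "real \<Rightarrow> real"
  assumes f: "integrable lborel f"
    and zero: "\<And>c. (LBINT x:{c<..}. f x) = 0"
  shows "AE x in lborel. f x = 0"
proof -
  define fp fm where "fp x = max 0 (f x)" and "fm x = max 0 (- f x)" for x
  have [measurable]: "f \<in> borel_measurable borel" using f by auto
  have fpm: "f x = fp x - fm x" for x by (auto simp: fp_def fm_def)
  have ip: "integrable lborel fp" and im: "integrable lborel fm"
    unfolding fp_def fm_def using f by auto
  have [measurable]: "fp \<in> borel_measurable borel" "fm \<in> borel_measurable borel"
    using ip im by auto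
  have nn: "0 \<le> fp x" "0 \<le> fm x" for x by (auto simp: fp_def fm_def)
  have em: "emeasure (density lborel g) {c<..} = ennreal (LBINT x:{c<..}. g x)"
    if g: "integrable lborel g" "\<And>x. 0 \<le> g x" for g :: "real \<Rightarrow> real" and c
  proof -
    have [measurable]: "g \<in> borel_measurable borel" using g by auto
    have "emeasure (density lborel g) {c<..} = (\<integral>\<^sup>+ x. ennreal (indicator {c<..} x * g x) \<partial>lborel)"
      by (subst emeasure_density) (auto intro!: nn_integral_cong simp: indicator_def)
    also have "\<dots> = ennreal (\<integral>x. indicator {c<..} x * g x \<partial>lborel)"
      using g integrable_mult_indicator[of "{c<..}" lborel g]
      by (intro nn_integral_eq_integral) auto
    finally show ?thesis by (simp add: set_lebesgue_integral_def)
  qed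
  have eq: "(LBINT x:{c<..}. fp x) = (LBINT x:{c<..}. fm x)" for c
  proof -
    have "(LBINT x:{c<..}. fp x - fm x) = (LBINT x:{c<..}. fp x) - (LBINT x:{c<..}. fm x)"
      
      using integrable_mult_indicator[of "{c<..}" lborel fp] integrable_mult_indicator[of "{c<..}" lborel fm] ip im
      by (intro set_integral_diff) (auto simp: set_integrable_def)
    with zero[of c] show ?thesis by (simp add: fpm)
  qed
  have "density lborel fp = density lborel fm"
    by (rule measure_eqI_lessThan) (auto simp: em ip im nn eq)
  then have "AE x in lborel. ennreal (fp x) = ennreal (fm x)"
    by (subst (asm) sigma_finite_measure.density_unique_iff[OF sigma_finite_lborel]) auto
  then show ?thesis by eventually_elim (use nn in \<open>auto simp: fpm\<close>)
qed

definition C1_real :: "(real \<Rightarrow> real) \<Rightarrow> (real \<Rightarrow> real) \<Rightarrow> bool" where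
  "C1_real g g' \<longleftrightarrow> (\<forall>s. (g has_real_derivative g' s) (at s)) \<and> continuous_on UNIV g'"

lemma C1_real_continuous: "C1_real g g' \<Longrightarrow> continuous_on S g"
  unfolding C1_real_def by (meson DERIV_isCont continuous_at_imp_continuous_on)

lemma logistic_C1:
  "C1_real (\<lambda>s. 1 / (1 + exp (n * (c - s)))) (\<lambda>s. n * exp (n * (c - s)) / (1 + exp (n * (c - s)))\<^sup>2)"
proof -
  have p: "1 + exp y \<noteq> 0" for y :: real using exp_gt_zero[of y] by linarith
  show ?thesis
    unfolding C1_real_def
    by (auto intro!: derivative_eq_intros continuous_intros simp: p power2_eq_square)
qed

lemma logistic_tendsto:
  fixes c s :: real assumes "s \<noteq> c"
  shows "(\<lambda>n. 1 / (1 + exp (real n * (c - s)))) \<longlonglongrightarrow> indicator {c<..} s"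
proof (cases "s > c")
  case True
  then have "filterlim (\<lambda>n. real n * (c - s)) at_bot sequentially"
    using filterlim_tendsto_neg_mult_at_bot[OF tendsto_const _ filterlim_real_sequentially, of "c - s"]
    by (simp add: mult.commute)
  then have "(\<lambda>n. exp (real n * (c - s))) \<longlonglongrightarrow> 0"
    by (rule filterlim_compose[OF exp_at_bot])
  then have "(\<lambda>n. 1 / (1 + exp (real n * (c - s)))) \<longlonglongrightarrow> 1 / (1 + 0)"
    by (intro tendsto_intros) auto
  then show ?thesis using True by simp
next
  case False
  then have "filterlim (\<lambda>n. real n * (c - s)) at_top sequentially"
    using assms filterlim_tendsto_pos_mult_at_top[OF tendsto_const _ filterlim_real_sequentially, of "c - s"]
    by (simp add: mult.commute)
  then have "filterlim (\<lambda>n. exp (real n * (c - s))) at_top sequentially"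
    by (rule filterlim_compose[OF exp_at_top])
  then have "(\<lambda>n. 1 / (1 + exp (real n * (c - s)))) \<longlonglongrightarrow> 0"
    by (intro tendsto_divide_0[OF tendsto_const] filterlim_at_top_imp_at_infinity
        filterlim_tendsto_add_at_top[OF tendsto_const])
  then show ?thesis using False by simp
qed

text \<open>Steep logistic functions are \<open>C\<^sup>1\<close>, bounded by \<open>1\<close> and converge to the indicator of a half-line
  except at one point, so dominated convergence reduces the claim to half-lines.\<close>

lemma AE_zero_if_C1_moments_zero:
  fixes f :: "real \<Rightarrow> real"
  assumes f: "integrable lborel f"
    and zero: "\<And>g g'. C1_real g g' \<Longrightarrow> (LBINT s. f s * g s) = 0"
  shows "AE x in lborel. f x = 0"
proof (rule AE_zero_if_half_line_integrals_zero[OF f])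
  fix c :: real
  have [measurable]: "f \<in> borel_measurable borel" using f by auto
  define \<sigma> where "\<sigma> n s = 1 / (1 + exp (real n * (c - s)))" for n s
  have [measurable]: "\<sigma> n \<in> borel_measurable borel" for n
    unfolding \<sigma>_def by measurable
  have bd: "\<bar>\<sigma> n s\<bar> \<le> 1" for n s
    unfolding \<sigma>_def using exp_ge_zero[of "real n * (c - s)"] by (simp add: add_pos_nonneg)
  have "(\<lambda>n. LBINT s. f s * \<sigma> n s) \<longlonglongrightarrow> (LBINT s. f s * indicator {c<..} s)"
  proof (rule integral_dominated_convergence[where w="\<lambda>s. \<bar>f s\<bar>"])
    have "AE s in lborel. s \<noteq> c" by (rule AE_lborel_singleton)
    then show "AE s in lborel. (\<lambda>n. f s * \<sigma> n s) \<longlonglongrightarrow> f s * indicator {c<..} s"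
      by eventually_elim (unfold \<sigma>_def, intro tendsto_mult tendsto_const logistic_tendsto)
    show "AE s in lborel. norm (f s * \<sigma> n s) \<le> \<bar>f s\<bar>" for n
      using mult_left_mono[OF bd[of n], of "\<bar>f _\<bar>"] by (auto simp: abs_mult)
  qed (use f in auto)
  moreover have "(LBINT s. f s * \<sigma> n s) = 0" for n
    unfolding \<sigma>_def by (rule zero[OF logistic_C1])
  ultimately have "(LBINT s. f s * indicator {c<..} s) = 0"
    by (simp add: LIMSEQ_const_iff)
  then show "(LBINT x:{c<..}. f x) = 0"
    by (simp add: set_lebesgue_integral_def mult.commute)
qed

section \<open>Free transport\<close>

text \<open>The hypothesis \<open>weak\<close> is what remains of \<open>z\<^sub>t = b z\<^sub>x\<close>, \<open>z(0,t) = 0\<close> after testing with functions that are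
  constant along characteristics.  Every bit of the initial profile has at time \<open>T\<close> either moved along its
  characteristic or left through \<open>x = 1\<close>, and after the travel time everything has left.\<close>

lemma transport_energy:
  fixes z0 zT \<zeta> :: "real \<Rightarrow> real"
  assumes b: "b < 0" and T: "T \<ge> 0"
    and z0: "L2_unit z0" and zT: "L2_unit zT"
    and \<zeta>m: "set_borel_measurable borel {0..T} \<zeta>"
    and \<zeta>i: "set_integrable lborel {0..T} (\<lambda>t. (\<zeta> t)\<^sup>2)"
    and weak: "\<And>g g'. C1_real g g' \<Longrightarrow>
      (LBINT x:{0..1}. zT x * g (x + b * T)) - (LBINT x:{0..1}. z0 x * g x) =
      b * (LBINT t:{0..T}. \<zeta> t * g (1 + b * t))"
  shows "(LBINT x:{0..1}. (zT x)\<^sup>2) - b * (LBINT t:{0..T}. (\<zeta> t)\<^sup>2) = (LBINT x:{0..1}. (z0 x)\<^sup>2)"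
    and "- b * T \<ge> 1 \<Longrightarrow> (LBINT x:{0..1}. (zT x)\<^sup>2) = 0"
proof -
  define P0 where "P0 x = indicator {0..1} x *\<^sub>R z0 x" for x
  define P1 where "P1 s = indicator {0..1} (s - b * T) *\<^sub>R zT (s - b * T)" for s
  define P2 where "P2 s = indicator {0..T} ((s - 1) / b) *\<^sub>R \<zeta> ((s - 1) / b)" for s
  have shift1: "(LBINT s. P1 s * h s) = (LBINT x:{0..1}. zT x * h (x + b * T))" for h
    by (subst lborel_integral_real_affine[of 1 _ "b * T"])
       (auto simp: P1_def set_lebesgue_integral_def add.commute mult_ac)
  have shift2: "(LBINT s. P2 s * h s) = - b * (LBINT t:{0..T}. \<zeta> t * h (1 + b * t))" for h
    using b by (subst lborel_integral_real_affine[of b _ 1])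
       (auto simp: P2_def set_lebesgue_integral_def add.commute mult_ac)
  have shift0: "(LBINT s. P0 s * h s) = (LBINT x:{0..1}. z0 x * h x)" for h
    by (simp add: P0_def set_lebesgue_integral_def mult_ac)
  have ishift1: "integrable lborel (\<lambda>s. P1 s * h s) \<longleftrightarrow> set_integrable lborel {0..1} (\<lambda>x. zT x * h (x + b * T))" for h
    by (subst lborel_integrable_real_affine_iff[of 1 _ "b * T", symmetric])
       (auto simp: P1_def set_integrable_def add.commute mult_ac)
  have ishift2: "integrable lborel (\<lambda>s. P2 s * h s) \<longleftrightarrow> set_integrable lborel {0..T} (\<lambda>t. \<zeta> t * h (1 + b * t))" for h
    using b by (subst lborel_integrable_real_affine_iff[of b _ 1, symmetric])
       (auto simp: P2_def set_integrable_def add.commute mult_ac)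
  have ishift0: "integrable lborel (\<lambda>s. P0 s * h s) \<longleftrightarrow> set_integrable lborel {0..1} (\<lambda>x. z0 x * h x)" for h
    by (simp add: P0_def set_integrable_def mult_ac)
  have L1: "set_integrable lborel {0..1} z0" "set_integrable lborel {0..1} zT" "set_integrable lborel {0..T} \<zeta>"
    using z0 zT \<zeta>m \<zeta>i by (auto simp: L2_unit_def intro: square_integrable_imp_integrable)
  have iP: "integrable lborel P0" "integrable lborel P1" "integrable lborel P2"
    using ishift0[of "\<lambda>_. 1"] ishift1[of "\<lambda>_. 1"] ishift2[of "\<lambda>_. 1"] L1 by auto
  \<comment> \<open>In the characteristic coordinate \<open>s = x + b t\<close> the initial profile \<open>P0\<close>, the profile \<open>P1\<close> at time \<open>T\<close>
  and the outflow \<open>P2\<close> up to time \<open>T\<close> become functions on the line with equal moments.\<close>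
  have "AE s in lborel. P1 s + P2 s - P0 s = 0"
  proof (rule AE_zero_if_C1_moments_zero)
    show "integrable lborel (\<lambda>s. P1 s + P2 s - P0 s)" using iP by auto
    fix g g' assume g: "C1_real g g'"
    note c = continuous_on_compose2[OF C1_real_continuous[OF g, of UNIV]]
    have "integrable lborel (\<lambda>s. P0 s * g s)" "integrable lborel (\<lambda>s. P1 s * g s)" "integrable lborel (\<lambda>s. P2 s * g s)"
      unfolding ishift0 ishift1 ishift2
      by (intro set_integrable_mult_continuous L1 c continuous_intros; simp)+
    then have "(LBINT s. (P1 s + P2 s - P0 s) * g s) = (LBINT s. P1 s * g s) + (LBINT s. P2 s * g s) - (LBINT s. P0 s * g s)"
      by (simp add: algebra_simps)
    also have "\<dots> = 0" unfolding shift0 shift1 shift2 using weak[OF g] by simp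
    finally show "(LBINT s. (P1 s + P2 s - P0 s) * g s) = 0" .
  qed
  moreover have "AE s in lborel. s \<noteq> 1 + b * T" by (rule AE_lborel_singleton)
  ultimately have split: "AE s in lborel. s \<noteq> 1 + b * T \<and> P0 s = P1 s + P2 s"
    by eventually_elim auto
  \<comment> \<open>Mass still inside at time \<open>T\<close> lies to the left of \<open>1 + b * T\<close> and mass that has left lies to the right,
  so that no cross term appears when \<open>P1 + P2\<close> is squared.\<close>
  have P1_supp: "P1 s = 0" if "s > 1 + b * T" for s
    using that by (auto simp: P1_def indicator_def)
  have P2_supp: "P2 s = 0" if "s < 1 + b * T" for s
  proof -
    have "T < (s - 1) / b" using that b by (simp add: field_simps)
    then show ?thesis by (auto simp: P2_def indicator_def)
  qed
  have P1sq: "(LBINT s. P1 s * P1 s) = (LBINT x:{0..1}. (zT x)\<^sup>2)"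
     unfolding shift1 by (intro set_lebesgue_integral_cong) (auto simp: P1_def power2_eq_square)
  have P2sq: "(LBINT s. P2 s * P2 s) = - b * (LBINT t:{0..T}. (\<zeta> t)\<^sup>2)"
     unfolding shift2 using b by (intro arg_cong2[where f="(*)"] refl set_lebesgue_integral_cong) (auto simp: P2_def power2_eq_square)
  have P0sq: "(LBINT s. P0 s * P0 s) = (LBINT x:{0..1}. (z0 x)\<^sup>2)"
     unfolding shift0 by (intro set_lebesgue_integral_cong) (auto simp: P0_def power2_eq_square)
  have i1: "integrable lborel (\<lambda>s. P1 s * P1 s)"
    unfolding ishift1 using zT
    by (subst set_integrable_cong[OF refl refl, where f'="\<lambda>x. (zT x)\<^sup>2"])
       (auto simp: P1_def L2_unit_def power2_eq_square)
  have i2: "integrable lborel (\<lambda>s. P2 s * P2 s)"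
    unfolding ishift2 using \<zeta>i b
    by (subst set_integrable_cong[OF refl refl, where f'="\<lambda>x. (\<zeta> x)\<^sup>2"])
       (auto simp: P2_def L2_unit_def power2_eq_square)
  have [measurable]: "P0 \<in> borel_measurable borel" "P1 \<in> borel_measurable borel" "P2 \<in> borel_measurable borel"
    using iP by auto
  have "(LBINT s. P0 s * P0 s) = (LBINT s. P1 s * P1 s + P2 s * P2 s)"
  proof (rule integral_cong_AE)
    show "AE s in lborel. P0 s * P0 s = P1 s * P1 s + P2 s * P2 s"
      using split
    proof eventually_elim
      fix s assume "s \<noteq> 1 + b * T \<and> P0 s = P1 s + P2 s"
      then show "P0 s * P0 s = P1 s * P1 s + P2 s * P2 s"
        using P1_supp[of s] P2_supp[of s] by (cases "s > 1 + b * T") (auto simp: not_less)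
    qed
  qed simp_all
  also have "\<dots> = (LBINT s. P1 s * P1 s) + (LBINT s. P2 s * P2 s)"
    using i1 i2 by simp
  finally show "(LBINT x:{0..1}. (zT x)\<^sup>2) - b * (LBINT t:{0..T}. (\<zeta> t)\<^sup>2) = (LBINT x:{0..1}. (z0 x)\<^sup>2)"
    unfolding P0sq P1sq P2sq by simp
  \<comment> \<open>Now \<open>1 + b * T \<le> 0\<close>, so \<open>P1\<close> lives on \<open>s \<le> 0\<close>, where the initial profile vanishes.\<close>
  assume late: "- b * T \<ge> 1"
  have "AE s in lborel. s \<noteq> (0::real)" by (rule AE_lborel_singleton)
  with split have "AE s in lborel. P1 s * P1 s = 0"
  proof eventually_elim
    fix s assume "s \<noteq> 1 + b * T \<and> P0 s = P1 s + P2 s" "s \<noteq> 0"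
    then show "P1 s * P1 s = 0"
      using P1_supp[of s] P2_supp[of s] late
      by (cases "s > 1 + b * T") (auto simp: not_less P0_def indicator_def)
  qed
  then have "(LBINT s. P1 s * P1 s) = 0" by (rule integral_eq_zero_AE)
  then show "(LBINT x:{0..1}. (zT x)\<^sup>2) = 0" unfolding P1sq .
qed

lemma transport_outflow_late:
  fixes \<zeta> :: "real \<Rightarrow> real"
  assumes i: "set_integrable lborel {0..T} (\<lambda>t. (\<zeta> t)\<^sup>2)" and \<tau>: "0 \<le> \<tau>" "\<tau> \<le> T"
    and eq: "(LBINT t:{0..T}. (\<zeta> t)\<^sup>2) = (LBINT t:{0..\<tau>}. (\<zeta> t)\<^sup>2)"
  shows "AE t in lborel. t \<in> {\<tau><..T} \<longrightarrow> \<zeta> t = 0"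
proof -
  have i2: "set_integrable lborel {0..\<tau>} (\<lambda>t. (\<zeta> t)\<^sup>2)" "set_integrable lborel {\<tau><..T} (\<lambda>t. (\<zeta> t)\<^sup>2)"
    using \<tau> by (auto intro: set_integrable_subset[OF i])
  have "(LBINT t:{0..\<tau>} \<union> {\<tau><..T}. (\<zeta> t)\<^sup>2) = (LBINT t:{0..\<tau>}. (\<zeta> t)\<^sup>2) + (LBINT t:{\<tau><..T}. (\<zeta> t)\<^sup>2)"
    using i2 by (intro set_integral_Un) auto
  moreover have "{0..\<tau>} \<union> {\<tau><..T} = {0..T}" using \<tau> by auto
  ultimately have "(LBINT t:{\<tau><..T}. (\<zeta> t)\<^sup>2) = 0" using eq by simp
  then have "AE t in lborel. indicator {\<tau><..T} t *\<^sub>R (\<zeta> t)\<^sup>2 = 0"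
    unfolding set_lebesgue_integral_def
    by (subst (asm) integral_nonneg_eq_0_iff_AE) (use i2 in \<open>auto simp: set_integrable_def\<close>)
  then show ?thesis by eventually_elim (auto simp: indicator_def split: if_splits)
qed

section \<open>Caratheodory solutions\<close>

lemma LBINT_FTC:
  fixes h h' :: "real \<Rightarrow> real"
  assumes "p \<le> q" "\<And>t. t \<in> {p..q} \<Longrightarrow> (h has_real_derivative h' t) (at t within {p..q})"
    and "continuous_on {p..q} h'"
  shows "(LBINT t:{p..q}. h' t) = h q - h p"
  using integral_FTC_atLeastAtMost[of p q h h'] assms
  by (auto simp: set_lebesgue_integral_def has_real_derivative_iff_has_vector_derivative)

lemma caratheodory_derivD:
  assumes "caratheodory_deriv z F" "t \<ge> 0"
  shows "set_integrable lborel {0..t} F" "z t = z 0 + (LBINT s:{0..t}. F s)"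
  using assms unfolding caratheodory_deriv_def by blast+

lemma caratheodory_deriv_continuous:
  assumes z: "caratheodory_deriv z F"
  shows "continuous_on {0..T} z"
proof (cases "T \<ge> 0")
  case True
  have F: "set_integrable lborel {0..t} F" if "t \<ge> 0" for t
    using caratheodory_derivD[OF z that] by blast
  have eq: "z t = z 0 + integral {0..t} F" if "t \<in> {0..T}" for t
    using caratheodory_derivD(2)[OF z, of t] that set_borel_integral_eq_integral(2)[OF F[of t]] by simp
  have "continuous_on {0..T} (\<lambda>t. z 0 + integral {0..t} F)"
    using set_borel_integral_eq_integral(1)[OF F[OF True]]
    by (intro continuous_intros indefinite_integral_continuous_1)
  then show ?thesis by (rule continuous_on_eq) (rule eq[symmetric])
qed auto

text \<open>Since \<open>z\<close> is only an indefinite integral of \<open>F\<close>, integration by parts is obtained from Fubini's theorem.\<close>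

lemma caratheodory_product_rule:
  fixes h h' z F :: "real \<Rightarrow> real"
  assumes z: "caratheodory_deriv z F" and T: "T \<ge> 0"
    and h: "\<And>t. t \<in> {0..T} \<Longrightarrow> (h has_real_derivative h' t) (at t within {0..T})"
    and h': "continuous_on {0..T} h'"
  shows "h T * z T - h 0 * z 0 = (LBINT t:{0..T}. h' t * z t + F t * h t)"
proof -
  note F = caratheodory_derivD(1)[OF z] and zt = caratheodory_derivD(2)[OF z]
  have hc: "continuous_on {0..T} h"
    using DERIV_continuous_on[of "{0..T}" h h'] h by blast
  have zc: "continuous_on {0..T} z" by (rule caratheodory_deriv_continuous[OF z])
  have hFi: "set_integrable lborel {0..T} (\<lambda>t. F t * h t)"
    by (rule set_integrable_mult_continuous[OF F[OF T] hc])
  have hzi: "set_integrable lborel {0..T} (\<lambda>t. h' t * z t)"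
    by (intro borel_integrable_atLeastAtMost' continuous_intros h' zc)
  \<comment> \<open>Both iterated integrals below are those of \<open>h' t * F s\<close> over the triangle \<open>0 \<le> s \<le> t \<le> T\<close>.\<close>
  define k where "k t = indicator {0..T} t * h' t" for t
  define f where "f s = indicator {0..T} s * F s" for s
  have ki: "integrable lborel k"
    unfolding k_def using borel_integrable_atLeastAtMost'[OF h'] by (simp add: set_integrable_def)
  have fi: "integrable lborel f"
    unfolding f_def using F[OF T] by (simp add: set_integrable_def)
  have [measurable]: "k \<in> borel_measurable borel" "f \<in> borel_measurable borel"
    using ki fi by auto
  have prod: "integrable (lborel \<Otimes>\<^sub>M lborel) (\<lambda>(t, s). k t * f s)"
  proof (rule lborel_pair.Fubini_integrable)
    show "AE x in lborel. integrable lborel (\<lambda>y. (\<lambda>(t, s). k t * f s) (x, y))" using fi by auto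
    show "integrable lborel (\<lambda>x. LBINT y. norm ((\<lambda>(t, s). k t * f s) (x, y)))"
      using ki by (auto simp: abs_mult)
  qed auto
  have "closed {p::real \<times> real. snd p \<le> fst p}"
    by (intro closed_Collect_le continuous_intros)
  then have [measurable]: "{p::real \<times> real. snd p \<le> fst p} \<in> sets (lborel \<Otimes>\<^sub>M lborel)"
    by (simp only: lborel_prod sets_lborel borel_closed)
  have "integrable (lborel \<Otimes>\<^sub>M lborel) (\<lambda>p. indicator {p. snd p \<le> fst p} p *\<^sub>R (\<lambda>(t, s). k t * f s) p)"
    by (intro integrable_mult_indicator prod) fact
  also have "(\<lambda>p. indicator {p. snd p \<le> fst p} p *\<^sub>R (\<lambda>(t, s). k t * f s) p) =
      (\<lambda>(t, s). (if s \<le> t then k t * f s else 0))"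
    by (auto simp: indicator_def fun_eq_iff)
  finally have tri: "integrable (lborel \<Otimes>\<^sub>M lborel) (\<lambda>(t, s). (if s \<le> t then k t * f s else 0))" .
  have inner_s: "(LBINT s. (if s \<le> t then k t * f s else 0)) = indicator {0..T} t * (h' t * (z t - z 0))" for t
  proof (cases "t \<in> {0..T}")
    case True
    have "(LBINT s. (if s \<le> t then k t * f s else 0)) = (LBINT s. h' t * (indicator {0..t} s * F s))"
      using True by (intro Bochner_Integration.integral_cong) (auto simp: k_def f_def indicator_def)
    also have "\<dots> = h' t * (z t - z 0)"
    proof -
      have "z t - z 0 = (LBINT s:{0..t}. F s)" using zt[of t] True by auto
      then show ?thesis by (simp add: set_lebesgue_integral_def)
    qed
    finally show ?thesis using True by simp
  next
    case False
    then have "k t = 0" by (simp add: k_def)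
    then show ?thesis using False by (simp cong: if_cong)
  qed
  have inner_t: "(LBINT t. (if s \<le> t then k t * f s else 0)) = indicator {0..T} s * (F s * (h T - h s))" for s
  proof (cases "s \<in> {0..T}")
    case True
    have "(LBINT t. (if s \<le> t then k t * f s else 0)) = (LBINT t. F s * (indicator {s..T} t * h' t))"
      using True by (intro Bochner_Integration.integral_cong) (auto simp: k_def f_def indicator_def)
    also have "(LBINT t. F s * (indicator {s..T} t * h' t)) = F s * (LBINT t:{s..T}. h' t)"
      by (simp add: set_lebesgue_integral_def)
    also have "(LBINT t:{s..T}. h' t) = h T - h s"
      using True by (intro LBINT_FTC continuous_on_subset[OF h'] DERIV_subset[OF h]) auto
    finally show ?thesis using True by simp
  next
    case False
    then have "f s = 0" by (simp add: f_def)
    then show ?thesis using False by (simp cong: if_cong)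
  qed
  have "(LBINT t:{0..T}. h' t * (z t - z 0)) = (LBINT s:{0..T}. F s * (h T - h s))"
    using lborel_pair.Fubini_integral[OF tri] inner_s inner_t
    by (simp add: set_lebesgue_integral_def)
  moreover have "(LBINT t:{0..T}. h' t * (z t - z 0)) = (LBINT t:{0..T}. h' t * z t) - (h T - h 0) * z 0"
  proof -
    have "(LBINT t:{0..T}. h' t * (z t - z 0)) = (LBINT t:{0..T}. h' t * z t - h' t * z 0)"
      by (simp add: algebra_simps)
    also have "\<dots> = (LBINT t:{0..T}. h' t * z t) - (LBINT t:{0..T}. h' t) * z 0"
      using hzi borel_integrable_atLeastAtMost'[OF h'] by (subst set_integral_diff) auto
    also have "(LBINT t:{0..T}. h' t) = h T - h 0" by (rule LBINT_FTC[OF T h h'])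
    finally show ?thesis .
  qed
  moreover have "(LBINT s:{0..T}. F s * (h T - h s)) = (z T - z 0) * h T - (LBINT s:{0..T}. F s * h s)"
  proof -
    have "(LBINT s:{0..T}. F s * (h T - h s)) = (LBINT s:{0..T}. F s * h T - F s * h s)"
      by (simp add: algebra_simps)
    also have "\<dots> = (LBINT s:{0..T}. F s) * h T - (LBINT s:{0..T}. F s * h s)"
      using hFi F[OF T] by (subst set_integral_diff) auto
    also have "(LBINT s:{0..T}. F s) = z T - z 0" using zt[OF T] by linarith
    finally show ?thesis .
  qed
  ultimately have "(LBINT t:{0..T}. h' t * z t) + (LBINT t:{0..T}. F t * h t) = h T * z T - h 0 * z 0"
    by (simp add: algebra_simps)
  then show ?thesis using hzi hFi by (subst set_integral_add) auto
qed

lemma caratheodory_deriv_if_derivative: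
  assumes z: "\<And>t. t \<ge> 0 \<Longrightarrow> (z has_real_derivative F t) (at t within {0..})"
    and F: "continuous_on {0..} F"
  shows "caratheodory_deriv z F"
  unfolding caratheodory_deriv_def
proof (intro allI impI conjI)
  fix t :: real assume t: "t \<ge> 0"
  have c: "continuous_on {0..t} F" by (rule continuous_on_subset[OF F]) auto
  show "set_integrable lborel {0..t} F" by (rule borel_integrable_atLeastAtMost'[OF c])
  show "z t = z 0 + (LBINT s:{0..t}. F s)"
    using LBINT_FTC[OF t DERIV_subset[OF z] c] by fastforce
qed

lemma caratheodory_deriv_diff:
  assumes "caratheodory_deriv z F" "caratheodory_deriv w G"
  shows "caratheodory_deriv (\<lambda>t. z t - w t) (\<lambda>t. F t - G t)"
  unfolding caratheodory_deriv_def
proof (intro allI impI conjI)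
  fix t :: real assume t: "t \<ge> 0"
  note zD = caratheodory_derivD[OF assms(1) t] and wD = caratheodory_derivD[OF assms(2) t]
  show "set_integrable lborel {0..t} (\<lambda>t. F t - G t)"
    using zD(1) wD(1) by simp
  show "z t - w t = z 0 - w 0 + (LBINT s:{0..t}. F s - G s)"
    using zD wD by (subst set_integral_diff) linarith+
qed

section \<open>Stable planar systems with an input of finite duration\<close>

text \<open>\<open>\<beta>\<close> is the impulse response of \<open>\<beta>'' = tr \<beta>' - dt \<beta>\<close>.  By the Cayley-Hamilton theorem it generates the exponential of
  every real matrix \<open>M\<close> of order two with trace \<open>tr\<close> and determinant \<open>dt\<close>, namely \<open>exp (t M) = (\<beta>' - tr \<beta>) I + \<beta> M\<close>.\<close>

lemma second_order_decay:
  fixes tr dt :: real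
  assumes roots: "\<And>k::complex. k\<^sup>2 - of_real tr * k + of_real dt = 0 \<Longrightarrow> Re k < 0"
  obtains \<beta> \<beta>' :: "real \<Rightarrow> real" and K \<mu> :: real where
    "\<And>t. (\<beta> has_real_derivative \<beta>' t) (at t)"
    "\<And>t. (\<beta>' has_real_derivative tr * \<beta>' t - dt * \<beta> t) (at t)"
    "\<beta> 0 = 0" "\<beta>' 0 = 1" "K > 0" "\<mu> > 0"
    "\<And>t. t \<ge> 0 \<Longrightarrow> \<bar>\<beta> t\<bar> \<le> K * exp (- \<mu> * t)"
    "\<And>t. t \<ge> 0 \<Longrightarrow> \<bar>\<beta>' t\<bar> \<le> K * exp (- \<mu> * t)"
proof -
  \<comment> \<open>\<open>k1\<close> and \<open>k2\<close> are the roots of the characteristic polynomial; \<open>\<beta>\<close> is the real part of the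
  divided difference of \<open>exp (k t)\<close> at \<open>k1\<close>, \<open>k2\<close>, which for a double root degenerates to \<open>t * exp (k t)\<close>.\<close>
  define s where "s = csqrt (of_real (tr\<^sup>2 - 4 * dt))"
  define k1 k2 where "k1 = (of_real tr + s) / 2" and "k2 = (of_real tr - s) / 2"
  have s2: "s * s = of_real (tr\<^sup>2 - 4 * dt)" 
    unfolding s_def using power2_csqrt[of "of_real (tr\<^sup>2 - 4 * dt)"] by (simp only: power2_eq_square)
  have sum: "k1 + k2 = of_real tr" by (simp add: k1_def k2_def field_simps)
  have prod: "k1 * k2 = of_real dt" using s2 by (simp add: k1_def k2_def field_simps power2_eq_square)
  have k: "Re k1 < 0" "Re k2 < 0"
    by (rule roots, unfold sum[symmetric] prod[symmetric], simp add: algebra_simps power2_eq_square)+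
  \<comment> \<open>Half of the spectral gap is given away so that the factor \<open>t\<close> of the double root can be absorbed.\<close>
  define \<mu> where "\<mu> = min (- Re k1) (- Re k2) / 2"
  have \<mu>: "\<mu> > 0" "Re k1 \<le> - 2 * \<mu>" "Re k2 \<le> - 2 * \<mu>" using k by (auto simp: \<mu>_def)
  have e: "norm (exp (j * of_real t)) \<le> exp (- 2 * \<mu> * t)" if "t \<ge> 0" "j \<in> {k1, k2}" for t j
    using that \<mu> mult_right_mono[of "Re j" "- 2 * \<mu>" t] by auto
  have e': "norm (exp (j * of_real t)) \<le> exp (- \<mu> * t)" if "t \<ge> 0" "j \<in> {k1, k2}" for t j
    using e[OF that] that \<mu> by (elim order_trans) auto
  have "\<exists>B B' :: complex \<Rightarrow> complex. \<exists>K>0. 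
     (\<forall>z. (B has_field_derivative B' z) (at z)) \<and>
     (\<forall>z. (B' has_field_derivative (of_real tr * B' z - of_real dt * B z)) (at z)) \<and>
     B 0 = 0 \<and> B' 0 = 1 \<and>
     (\<forall>t\<ge>0. norm (B (of_real t)) \<le> K * exp (- \<mu> * t) \<and> norm (B' (of_real t)) \<le> K * exp (- \<mu> * t))"
  proof (cases "k1 = k2")
    case False
    define B B' where "B z = (exp (k1 * z) - exp (k2 * z)) / (k1 - k2)"
      and "B' z = (k1 * exp (k1 * z) - k2 * exp (k2 * z)) / (k1 - k2)" for z
    define N where "N = norm (k1 - k2)"
    have N: "N > 0" using False by (simp add: N_def)
    have "(B has_field_derivative B' z) (at z)" for z
      unfolding B_def[abs_def] B'_def
      by (intro DERIV_cdivide) (auto intro!: derivative_eq_intros simp: mult_ac)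
    moreover have "(B' has_field_derivative (of_real tr * B' z - of_real dt * B z)) (at z)" for z
    proof -
      have "(k1 * k1 * exp (k1 * z) - k2 * k2 * exp (k2 * z)) / (k1 - k2) =
          ((k1 + k2) * (k1 * exp (k1 * z) - k2 * exp (k2 * z)) - (k1 * k2) * (exp (k1 * z) - exp (k2 * z))) / (k1 - k2)"
        by (simp add: algebra_simps)
      also have "\<dots> = of_real tr * B' z - of_real dt * B z"
        by (subst diff_divide_distrib) (simp only: B_def B'_def sum prod times_divide_eq_right)
      finally have eq: "(k1 * k1 * exp (k1 * z) - k2 * k2 * exp (k2 * z)) / (k1 - k2) = of_real tr * B' z - of_real dt * B z" .
      show ?thesis
        unfolding eq[symmetric] unfolding B'_def[abs_def]
        by (intro DERIV_cdivide) (auto intro!: derivative_eq_intros simp: mult_ac)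
    qed
    moreover have "B 0 = 0" "B' 0 = 1" using False by (auto simp: B_def B'_def)
    moreover have "norm (B (of_real t)) \<le> ((2 + norm k1 + norm k2) / N) * exp (- \<mu> * t) \<and> 
        norm (B' (of_real t)) \<le> ((2 + norm k1 + norm k2) / N) * exp (- \<mu> * t)" if t: "t \<ge> 0" for t
    proof -
      have "norm (exp (k1 * of_real t) - exp (k2 * of_real t)) \<le> 2 * exp (- \<mu> * t)"
        using norm_triangle_ineq4[of "exp (k1 * of_real t)" "exp (k2 * of_real t)"]
          e'[OF t, of k1, OF insertI1] e'[OF t, of k2, OF insertI2[OF singletonI]] by linarith
      also have "\<dots> \<le> (2 + norm k1 + norm k2) * exp (- \<mu> * t)"
        by (intro mult_right_mono) auto
      finally have 1: "norm (exp (k1 * of_real t) - exp (k2 * of_real t)) \<le> (2 + norm k1 + norm k2) * exp (- \<mu> * t)" .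
      have "norm (k1 * exp (k1 * of_real t) - k2 * exp (k2 * of_real t)) \<le> norm k1 * exp (- \<mu> * t) + norm k2 * exp (- \<mu> * t)"
        using norm_triangle_ineq4[of "k1 * exp (k1 * of_real t)" "k2 * exp (k2 * of_real t)"]
          mult_left_mono[OF e'[OF t, of k1], of "norm k1"] mult_left_mono[OF e'[OF t, of k2], of "norm k2"]
        by (simp add: norm_mult)
      also have "\<dots> \<le> (2 + norm k1 + norm k2) * exp (- \<mu> * t)" by (simp add: algebra_simps)
      finally have 2: "norm (k1 * exp (k1 * of_real t) - k2 * exp (k2 * of_real t)) \<le> (2 + norm k1 + norm k2) * exp (- \<mu> * t)" .
      show ?thesis
        using 1 2 N by (simp add: B_def B'_def norm_divide N_def[symmetric] divide_right_mono)
    qed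
    moreover have "(2 + norm k1 + norm k2) / N > 0" using N by (auto intro!: divide_pos_pos add_pos_nonneg)
    ultimately show ?thesis by blast
  next
    case True
    define B B' where "B z = z * exp (k1 * z)" and "B' z = (1 + k1 * z) * exp (k1 * z)" for z
    have "(B has_field_derivative B' z) (at z)" for z
      unfolding B_def[abs_def] B'_def
      by (auto intro!: derivative_eq_intros simp: algebra_simps)
    moreover have "(B' has_field_derivative (of_real tr * B' z - of_real dt * B z)) (at z)" for z
      unfolding B_def B'_def[abs_def] sum[symmetric] prod[symmetric] True[symmetric]
      by (auto intro!: derivative_eq_intros simp: algebra_simps)
    moreover have "B 0 = 0" "B' 0 = 1" by (auto simp: B_def B'_def)
    moreover have "norm (B (of_real t)) \<le> (1 + (1 + norm k1) / \<mu>) * exp (- \<mu> * t) \<and> 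
        norm (B' (of_real t)) \<le> (1 + (1 + norm k1) / \<mu>) * exp (- \<mu> * t)" if t: "t \<ge> 0" for t
    proof -
      have t1: "t \<le> exp (\<mu> * t) / \<mu>"
        using exp_ge_add_one_self[of "\<mu> * t"] \<mu>(1) by (simp add: field_simps del: exp_ge_add_one_self)
      have "t * norm (exp (k1 * of_real t)) \<le> (exp (\<mu> * t) / \<mu>) * exp (- 2 * \<mu> * t)"
        using e[OF t, of k1] t1 t \<mu> by (intro mult_mono) auto
      also have "\<dots> = (1 / \<mu>) * exp (- \<mu> * t)" by (simp add: exp_add[symmetric])
      finally have 0: "t * norm (exp (k1 * of_real t)) \<le> (1 / \<mu>) * exp (- \<mu> * t)" .
      have "norm (B (of_real t)) \<le> (1 / \<mu>) * exp (- \<mu> * t)" using 0 t by (simp add: B_def norm_mult)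
      also have "\<dots> \<le> (1 + (1 + norm k1) / \<mu>) * exp (- \<mu> * t)"
        using \<mu> by (intro mult_right_mono) (auto simp: field_simps)
      finally have 1: "norm (B (of_real t)) \<le> (1 + (1 + norm k1) / \<mu>) * exp (- \<mu> * t)" .
      have "norm (B' (of_real t)) \<le> (1 + norm k1 * t) * norm (exp (k1 * of_real t))"
        unfolding B'_def norm_mult using norm_triangle_ineq[of 1 "k1 * of_real t"] t
        by (intro mult_right_mono) (auto simp: norm_mult)
      also have "\<dots> = norm (exp (k1 * of_real t)) + norm k1 * (t * norm (exp (k1 * of_real t)))"
        by (simp add: algebra_simps)
      also have "\<dots> \<le> exp (- \<mu> * t) + norm k1 * ((1 / \<mu>) * exp (- \<mu> * t))"
        using e'[OF t, of k1] mult_left_mono[OF 0, of "norm k1"] by (intro add_mono) auto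
      also have "\<dots> \<le> (1 + (1 + norm k1) / \<mu>) * exp (- \<mu> * t)"
        using \<mu> by (simp add: field_simps)
      finally show ?thesis using 1 by blast
    qed
    moreover have "1 + (1 + norm k1) / \<mu> > 0" using \<mu> by (auto intro!: add_pos_pos divide_pos_pos add_pos_nonneg)
    ultimately show ?thesis by blast
  qed
  then obtain B B' :: "complex \<Rightarrow> complex" and K where K: "K > 0" 
    and B: "\<And>z. (B has_field_derivative B' z) (at z)"
    and B': "\<And>z. (B' has_field_derivative (of_real tr * B' z - of_real dt * B z)) (at z)"
    and B0: "B 0 = 0" "B' 0 = 1"
    and bd: "\<And>t. t \<ge> 0 \<Longrightarrow> norm (B (of_real t)) \<le> K * exp (- \<mu> * t)"
      "\<And>t. t \<ge> 0 \<Longrightarrow> norm (B' (of_real t)) \<le> K * exp (- \<mu> * t)"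
    by blast
  have re: "((\<lambda>t. Re (G (of_real t))) has_real_derivative Re (G' (of_real t))) (at t)"
    if "\<And>z. (G has_field_derivative G' z) (at z)" for G G' :: "complex \<Rightarrow> complex" and t
    using bounded_linear.has_vector_derivative[OF bounded_linear_Re has_vector_derivative_real_field[OF that]]
    by (simp add: has_real_derivative_iff_has_vector_derivative)
  show ?thesis
  proof
    show "((\<lambda>t::real. Re (B (of_real t))) has_real_derivative Re (B' (of_real t))) (at t)" for t
      by (rule re[OF B])
    show "((\<lambda>t::real. Re (B' (of_real t))) has_real_derivative tr * Re (B' (of_real t)) - dt * Re (B (of_real t))) (at t)" for t
      using re[OF B', of t] by simp
    show "\<bar>Re (B (of_real t))\<bar> \<le> K * exp (- \<mu> * t)" if "t \<ge> 0" for t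
      using bd(1)[OF that] abs_Re_le_cmod order_trans by blast
    show "\<bar>Re (B' (of_real t))\<bar> \<le> K * exp (- \<mu> * t)" if "t \<ge> 0" for t
      using bd(2)[OF that] abs_Re_le_cmod order_trans by blast
  qed (use B0 K \<mu> in auto)
qed

text \<open>The pair \<open>e = (e1, e2)\<close> solves \<open>e' = e M\<close>, as the rows of \<open>exp (t M)\<close> do.  Pairing the solution at time \<open>s\<close> with
  this row at time \<open>T - s\<close> removes the homogeneous part.\<close>

lemma variation_of_constants:
  fixes e1 e2 :: "real \<Rightarrow> real"
  assumes x1: "caratheodory_deriv \<xi>1 (\<lambda>t. m11 * \<xi>1 t + m12 * \<xi>2 t + r1 t)"
    and x2: "caratheodory_deriv \<xi>2 (\<lambda>t. m21 * \<xi>1 t + m22 * \<xi>2 t + r2 t)"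
    and e1: "\<And>t. (e1 has_real_derivative e1 t * m11 + e2 t * m21) (at t)"
    and e2: "\<And>t. (e2 has_real_derivative e1 t * m12 + e2 t * m22) (at t)"
    and T: "T \<ge> 0"
  shows "e1 0 * \<xi>1 T + e2 0 * \<xi>2 T = e1 T * \<xi>1 0 + e2 T * \<xi>2 0 +
      (LBINT s:{0..T}. e1 (T - s) * r1 s + e2 (T - s) * r2 s)"
proof -
  have ce: "continuous_on S e1" "continuous_on S e2" for S
    using e1 e2 by (meson DERIV_isCont continuous_at_imp_continuous_on)+
  note ct = continuous_on_compose2[OF ce(1)[of UNIV]] continuous_on_compose2[OF ce(2)[of UNIV]]
  note cx = caratheodory_deriv_continuous[OF x1] caratheodory_deriv_continuous[OF x2]
  define d1 d2 where "d1 t = - (e1 (T - t) * m11 + e2 (T - t) * m21)"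
    and "d2 t = - (e1 (T - t) * m12 + e2 (T - t) * m22)" for t
  have cd: "continuous_on {0..T} d1" "continuous_on {0..T} d2"
    unfolding d1_def d2_def by (intro continuous_intros ct; simp)+
  have der: "((\<lambda>t. e1 (T - t)) has_real_derivative d1 t) (at t within S)"
     "((\<lambda>t. e2 (T - t)) has_real_derivative d2 t) (at t within S)" for t S
    unfolding d1_def d2_def
    by (rule DERIV_cong[OF DERIV_chain2[OF e1]] DERIV_cong[OF DERIV_chain2[OF e2]],
        auto intro!: derivative_eq_intros)+
  have F1: "set_integrable lborel {0..T} (\<lambda>t. m11 * \<xi>1 t + m12 * \<xi>2 t + r1 t)"
    and F2: "set_integrable lborel {0..T} (\<lambda>t. m21 * \<xi>1 t + m22 * \<xi>2 t + r2 t)"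
    by (rule caratheodory_derivD(1)[OF x1 T] caratheodory_derivD(1)[OF x2 T])+
  have i1: "set_integrable lborel {0..T} (\<lambda>t. d1 t * \<xi>1 t + (m11 * \<xi>1 t + m12 * \<xi>2 t + r1 t) * e1 (T - t))"
    by (intro set_integral_add set_integrable_mult_continuous F1 borel_integrable_atLeastAtMost' continuous_intros cd cx ct) auto
  have i2: "set_integrable lborel {0..T} (\<lambda>t. d2 t * \<xi>2 t + (m21 * \<xi>1 t + m22 * \<xi>2 t + r2 t) * e2 (T - t))"
    by (intro set_integral_add set_integrable_mult_continuous F2 borel_integrable_atLeastAtMost' continuous_intros cd cx ct) auto
  have "e1 0 * \<xi>1 T - e1 T * \<xi>1 0 + (e2 0 * \<xi>2 T - e2 T * \<xi>2 0) =
    (LBINT t:{0..T}. d1 t * \<xi>1 t + (m11 * \<xi>1 t + m12 * \<xi>2 t + r1 t) * e1 (T - t)) +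
    (LBINT t:{0..T}. d2 t * \<xi>2 t + (m21 * \<xi>1 t + m22 * \<xi>2 t + r2 t) * e2 (T - t))"
    using caratheodory_product_rule[OF x1 T der(1) cd(1)] caratheodory_product_rule[OF x2 T der(2) cd(2)]
    by simp
  also have "\<dots> = (LBINT t:{0..T}. (d1 t * \<xi>1 t + (m11 * \<xi>1 t + m12 * \<xi>2 t + r1 t) * e1 (T - t)) +
    (d2 t * \<xi>2 t + (m21 * \<xi>1 t + m22 * \<xi>2 t + r2 t) * e2 (T - t)))"
    using i1 i2 by (rule set_integral_add(2)[symmetric])
  also have "\<dots> = (LBINT s:{0..T}. e1 (T - s) * r1 s + e2 (T - s) * r2 s)"
    by (intro set_lebesgue_integral_cong) (auto simp: d1_def d2_def algebra_simps)
  finally show ?thesis by simp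
qed

text \<open>The input is zero after time \<open>\<tau>\<close>, so the kernel \<open>exp (- \<mu> * (T - s))\<close> may be replaced by
  \<open>exp (\<mu> * \<tau>) * exp (- \<mu> * T)\<close>.\<close>

lemma forced_mode_bound:
  fixes e1 e2 \<zeta> :: "real \<Rightarrow> real"
  assumes x1: "caratheodory_deriv \<xi>1 (\<lambda>t. m11 * \<xi>1 t + m12 * \<xi>2 t + l1 * \<zeta> t)"
    and x2: "caratheodory_deriv \<xi>2 (\<lambda>t. m21 * \<xi>1 t + m22 * \<xi>2 t + l2 * \<zeta> t)"
    and e1: "\<And>t. (e1 has_real_derivative e1 t * m11 + e2 t * m21) (at t)"
    and e2: "\<And>t. (e2 has_real_derivative e1 t * m12 + e2 t * m22) (at t)"
    and K: "\<And>t. t \<ge> 0 \<Longrightarrow> \<bar>e1 t\<bar> \<le> K * exp (- \<mu> * t)" "\<And>t. t \<ge> 0 \<Longrightarrow> \<bar>e2 t\<bar> \<le> K * exp (- \<mu> * t)"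
    and \<mu>: "\<mu> \<ge> 0" and T: "T \<ge> 0"
    and \<zeta>: "set_integrable lborel {0..T} \<zeta>"
    and late: "AE t in lborel. t \<in> {\<tau><..T} \<longrightarrow> \<zeta> t = 0"
  shows "\<bar>e1 0 * \<xi>1 T + e2 0 * \<xi>2 T\<bar> \<le>
      K * exp (- \<mu> * T) * (\<bar>\<xi>1 0\<bar> + \<bar>\<xi>2 0\<bar> + (\<bar>l1\<bar> + \<bar>l2\<bar>) * exp (\<mu> * \<tau>) * (LBINT t:{0..T}. \<bar>\<zeta> t\<bar>))"
proof -
  have K0: "K \<ge> 0" using K(1)[of 0] by simp
  have ce: "continuous_on S e1" "continuous_on S e2" for S
    using e1 e2 by (meson DERIV_isCont continuous_at_imp_continuous_on)+
  note ct = continuous_on_compose2[OF ce(1)[of UNIV]] continuous_on_compose2[OF ce(2)[of UNIV]]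
  define D where "D = K * exp (- \<mu> * T) * ((\<bar>l1\<bar> + \<bar>l2\<bar>) * exp (\<mu> * \<tau>))"
  have "set_integrable lborel {0..T} (\<lambda>s. \<zeta> s * (e1 (T - s) * l1 + e2 (T - s) * l2))"
    by (intro set_integrable_mult_continuous \<zeta> continuous_intros ct) auto
  then have i: "set_integrable lborel {0..T} (\<lambda>s. e1 (T - s) * (l1 * \<zeta> s) + e2 (T - s) * (l2 * \<zeta> s))"
    by (simp add: algebra_simps)
  have "\<bar>LBINT s:{0..T}. e1 (T - s) * (l1 * \<zeta> s) + e2 (T - s) * (l2 * \<zeta> s)\<bar> \<le>
      (LBINT s:{0..T}. \<bar>e1 (T - s) * (l1 * \<zeta> s) + e2 (T - s) * (l2 * \<zeta> s)\<bar>)"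
    using set_integral_norm_bound[OF i] by simp
  also have "(LBINT s:{0..T}. \<bar>e1 (T - s) * (l1 * \<zeta> s) + e2 (T - s) * (l2 * \<zeta> s)\<bar>) \<le> (LBINT s:{0..T}. D * \<bar>\<zeta> s\<bar>)"
  proof (rule set_integral_mono_AE)
    show "set_integrable lborel {0..T} (\<lambda>s. \<bar>e1 (T - s) * (l1 * \<zeta> s) + e2 (T - s) * (l2 * \<zeta> s)\<bar>)"
      using i by (rule set_integrable_abs)
    show "set_integrable lborel {0..T} (\<lambda>s. D * \<bar>\<zeta> s\<bar>)"
      using \<zeta> by (intro set_integrable_mult_right set_integrable_abs)
    show "AE s \<in> {0..T} in lborel. \<bar>e1 (T - s) * (l1 * \<zeta> s) + e2 (T - s) * (l2 * \<zeta> s)\<bar> \<le> D * \<bar>\<zeta> s\<bar>"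
      using late
    proof eventually_elim
      fix s assume z: "s \<in> {\<tau><..T} \<longrightarrow> \<zeta> s = 0"
      show "s \<in> {0..T} \<longrightarrow> \<bar>e1 (T - s) * (l1 * \<zeta> s) + e2 (T - s) * (l2 * \<zeta> s)\<bar> \<le> D * \<bar>\<zeta> s\<bar>"
      proof (cases "s \<in> {0..T} \<and> \<zeta> s \<noteq> 0")
        case True
        then have s: "s \<in> {0..T}" "s \<le> \<tau>" using z by auto
        have "exp (- \<mu> * (T - s)) \<le> exp (- \<mu> * T) * exp (\<mu> * \<tau>)"
          using s \<mu> by (simp add: exp_add[symmetric] algebra_simps mult_left_mono)
        then have "K * exp (- \<mu> * (T - s)) \<le> K * (exp (- \<mu> * T) * exp (\<mu> * \<tau>))" 
          by (rule mult_left_mono) (rule K0)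
        then have b: "\<bar>e1 (T - s)\<bar> \<le> K * (exp (- \<mu> * T) * exp (\<mu> * \<tau>))"
           "\<bar>e2 (T - s)\<bar> \<le> K * (exp (- \<mu> * T) * exp (\<mu> * \<tau>))"
          using K[of "T - s"] s by auto
        have "\<bar>e1 (T - s) * (l1 * \<zeta> s) + e2 (T - s) * (l2 * \<zeta> s)\<bar> \<le>
          \<bar>e1 (T - s)\<bar> * (\<bar>l1\<bar> * \<bar>\<zeta> s\<bar>) + \<bar>e2 (T - s)\<bar> * (\<bar>l2\<bar> * \<bar>\<zeta> s\<bar>)"
          by (rule order_trans[OF abs_triangle_ineq]) (simp add: abs_mult)
        also have "\<dots> \<le> K * (exp (- \<mu> * T) * exp (\<mu> * \<tau>)) * (\<bar>l1\<bar> * \<bar>\<zeta> s\<bar>) + 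
           K * (exp (- \<mu> * T) * exp (\<mu> * \<tau>)) * (\<bar>l2\<bar> * \<bar>\<zeta> s\<bar>)"
          by (intro add_mono mult_right_mono b) auto
        also have "\<dots> = D * \<bar>\<zeta> s\<bar>" by (simp add: D_def algebra_simps)
        finally show ?thesis by simp
      qed auto
    qed
  qed
  also have "(LBINT s:{0..T}. D * \<bar>\<zeta> s\<bar>) = D * (LBINT t:{0..T}. \<bar>\<zeta> t\<bar>)" by simp
  finally have f: "\<bar>LBINT s:{0..T}. e1 (T - s) * (l1 * \<zeta> s) + e2 (T - s) * (l2 * \<zeta> s)\<bar> \<le> 
     D * (LBINT t:{0..T}. \<bar>\<zeta> t\<bar>)" .
  have "\<bar>e1 T * \<xi>1 0 + e2 T * \<xi>2 0\<bar> \<le> \<bar>e1 T\<bar> * \<bar>\<xi>1 0\<bar> + \<bar>e2 T\<bar> * \<bar>\<xi>2 0\<bar>"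
    by (rule order_trans[OF abs_triangle_ineq]) (simp add: abs_mult)
  also have "\<dots> \<le> (K * exp (- \<mu> * T)) * \<bar>\<xi>1 0\<bar> + (K * exp (- \<mu> * T)) * \<bar>\<xi>2 0\<bar>"
    by (intro add_mono mult_right_mono K T) auto
  finally have "\<bar>e1 T * \<xi>1 0 + e2 T * \<xi>2 0\<bar> \<le> (K * exp (- \<mu> * T)) * (\<bar>\<xi>1 0\<bar> + \<bar>\<xi>2 0\<bar>)"
    by (simp add: algebra_simps)
  with f have "\<bar>e1 0 * \<xi>1 T + e2 0 * \<xi>2 T\<bar> \<le> (K * exp (- \<mu> * T)) * (\<bar>\<xi>1 0\<bar> + \<bar>\<xi>2 0\<bar>) + D * (LBINT t:{0..T}. \<bar>\<zeta> t\<bar>)"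
    unfolding variation_of_constants[OF x1 x2 e1 e2 T] by linarith
  also have "\<dots> = K * exp (- \<mu> * T) * (\<bar>\<xi>1 0\<bar> + \<bar>\<xi>2 0\<bar> + (\<bar>l1\<bar> + \<bar>l2\<bar>) * exp (\<mu> * \<tau>) * (LBINT t:{0..T}. \<bar>\<zeta> t\<bar>))"
    by (simp add: D_def algebra_simps)
  finally show ?thesis .
qed

text \<open>The Cauchy-Schwarz inequality for a function supported in \<open>{0..\<tau>}\<close>: the constant does not grow with \<open>T\<close>.\<close>

lemma integral_abs_square_le:
  fixes \<zeta> :: "real \<Rightarrow> real"
  assumes \<tau>: "\<tau> > 0"
    and m: "set_borel_measurable borel {0..T} \<zeta>" and i: "set_integrable lborel {0..T} (\<lambda>t. (\<zeta> t)\<^sup>2)"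
    and late: "AE t in lborel. t \<in> {\<tau><..T} \<longrightarrow> \<zeta> t = 0"
  shows "(LBINT t:{0..T}. \<bar>\<zeta> t\<bar>)\<^sup>2 \<le> \<tau> * (LBINT t:{0..T}. (\<zeta> t)\<^sup>2)"
proof -
  define I where "I = (LBINT t:{0..T}. \<bar>\<zeta> t\<bar>)"
  \<comment> \<open>\<open>q\<close> is the mean of \<open>\<bar>\<zeta>\<bar>\<close> over a time span \<open>\<tau>\<close>; the claim expresses that
  the square of the deviation from it has a nonnegative integral.\<close>
  define q where "q = I / \<tau>"
  have i1: "set_integrable lborel {0..T} (\<lambda>t. \<bar>\<zeta> t\<bar>)"
    by (rule set_integrable_abs[OF square_integrable_imp_integrable[OF m i]])
  have i0: "integrable lborel (indicat_real {0..\<tau>})"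
    using \<tau> by (intro integrable_real_indicator) auto
  have ic: "set_integrable lborel {0..T} (indicator {0..\<tau>} :: real \<Rightarrow> real)"
    unfolding set_integrable_def by (intro integrable_mult_indicator i0) auto
  have "(LBINT t:{0..T}. indicator {0..\<tau>} t) \<le> (LBINT t. indicat_real {0..\<tau>} t)"
    unfolding set_lebesgue_integral_def
    by (rule integral_mono[OF ic[unfolded set_integrable_def] i0]) (auto simp: indicator_def)
  then have c: "(LBINT t:{0..T}. indicator {0..\<tau>} t) \<le> \<tau>" using \<tau> by simp
  have "0 \<le> (LBINT t:{0..T}. ((\<zeta> t)\<^sup>2 - 2 * q * \<bar>\<zeta> t\<bar>) + q\<^sup>2 * indicator {0..\<tau>} t)"
    unfolding set_lebesgue_integral_def
  proof (rule integral_nonneg_AE)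
    show "AE t in lborel. 0 \<le> indicator {0..T} t *\<^sub>R (((\<zeta> t)\<^sup>2 - 2 * q * \<bar>\<zeta> t\<bar>) + q\<^sup>2 * indicator {0..\<tau>} t)"
      using late
    proof eventually_elim
      fix t assume "t \<in> {\<tau><..T} \<longrightarrow> \<zeta> t = 0"
      moreover have "0 \<le> (\<zeta> t)\<^sup>2 - 2 * q * \<bar>\<zeta> t\<bar> + q\<^sup>2"
        using zero_le_power2[of "\<bar>\<zeta> t\<bar> - q"] by (simp add: power2_diff mult_ac)
      ultimately show "0 \<le> indicator {0..T} t *\<^sub>R (((\<zeta> t)\<^sup>2 - 2 * q * \<bar>\<zeta> t\<bar>) + q\<^sup>2 * indicator {0..\<tau>} t)"
        by (auto simp: indicator_def)
    qed
  qed
  also have "\<dots> = (LBINT t:{0..T}. (\<zeta> t)\<^sup>2) - 2 * q * I + q\<^sup>2 * (LBINT t:{0..T}. indicator {0..\<tau>} t)"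
    unfolding I_def using i i1 ic by (subst set_integral_add set_integral_diff; simp)+
  also have "\<dots> \<le> (LBINT t:{0..T}. (\<zeta> t)\<^sup>2) - 2 * q * I + q\<^sup>2 * \<tau>"
    using c by (intro add_left_mono mult_left_mono) auto
  also have "\<dots> = (LBINT t:{0..T}. (\<zeta> t)\<^sup>2) - I\<^sup>2 / \<tau>"
    using \<tau> by (simp add: q_def power2_eq_square field_simps)
  finally show ?thesis using \<tau> by (simp add: field_simps I_def)
qed

text \<open>The rows of \<open>exp (t M)\<close> turn \<open>forced_mode_bound\<close> into a bound of each component by the integral of \<open>\<bar>\<zeta>\<bar>\<close>.  That integral is
  controlled by the energy of the input uniformly in \<open>T\<close> because the input stops at \<open>\<tau>\<close>.\<close>

lemma forced_system_decay:
  fixes m11 m12 m21 m22 l1 l2 \<tau> :: real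
  assumes roots: "\<And>k::complex. k\<^sup>2 - of_real (m11 + m22) * k + of_real (m11 * m22 - m12 * m21) = 0 \<Longrightarrow> Re k < 0"
    and \<tau>: "\<tau> > 0"
  obtains \<kappa> lam where "\<kappa> > 0" "lam > 0"
    "\<And>\<xi>1 \<xi>2 \<zeta> T. \<lbrakk>caratheodory_deriv \<xi>1 (\<lambda>t. m11 * \<xi>1 t + m12 * \<xi>2 t + l1 * \<zeta> t);
       caratheodory_deriv \<xi>2 (\<lambda>t. m21 * \<xi>1 t + m22 * \<xi>2 t + l2 * \<zeta> t); T \<ge> 0;
       set_borel_measurable borel {0..T} \<zeta>; set_integrable lborel {0..T} (\<lambda>t. (\<zeta> t)\<^sup>2);
       AE t in lborel. t \<in> {\<tau><..T} \<longrightarrow> \<zeta> t = 0\<rbrakk> \<Longrightarrow>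
       (\<xi>1 T)\<^sup>2 + (\<xi>2 T)\<^sup>2 \<le> \<kappa> * exp (- lam * T) * ((\<xi>1 0)\<^sup>2 + (\<xi>2 0)\<^sup>2 + (LBINT t:{0..T}. (\<zeta> t)\<^sup>2))"
proof (rule second_order_decay[of "m11 + m22" "m11 * m22 - m12 * m21"], rule roots, assumption)
  fix \<beta> \<beta>' :: "real \<Rightarrow> real" and K \<mu> :: real
  assume \<beta>: "\<And>t. (\<beta> has_real_derivative \<beta>' t) (at t)"
    and \<beta>': "\<And>t. (\<beta>' has_real_derivative (m11 + m22) * \<beta>' t - (m11 * m22 - m12 * m21) * \<beta> t) (at t)"
    and \<beta>0: "\<beta> 0 = 0" "\<beta>' 0 = 1" and K: "K > 0" and \<mu>: "\<mu> > 0"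
    and bd: "\<And>t. t \<ge> 0 \<Longrightarrow> \<bar>\<beta> t\<bar> \<le> K * exp (- \<mu> * t)"
    "\<And>t. t \<ge> 0 \<Longrightarrow> \<bar>\<beta>' t\<bar> \<le> K * exp (- \<mu> * t)"
  \<comment> \<open>The entries of \<open>exp (t M)\<close>.\<close>
  define e11 e12 e21 e22 where "e11 t = \<beta>' t - m22 * \<beta> t" and "e12 t = m12 * \<beta> t"
    and "e21 t = m21 * \<beta> t" and "e22 t = \<beta>' t - m11 * \<beta> t" for t
  have d: "(e11 has_real_derivative e11 t * m11 + e12 t * m21) (at t)"
    "(e12 has_real_derivative e11 t * m12 + e12 t * m22) (at t)"
    "(e21 has_real_derivative e21 t * m11 + e22 t * m21) (at t)"
    "(e22 has_real_derivative e21 t * m12 + e22 t * m22) (at t)" for t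
    unfolding e11_def[abs_def] e12_def[abs_def] e21_def[abs_def] e22_def[abs_def]
    by (auto intro!: derivative_eq_intros \<beta> \<beta>' simp: algebra_simps)
  define N where "N = 1 + \<bar>m11\<bar> + \<bar>m12\<bar> + \<bar>m21\<bar> + \<bar>m22\<bar>"
  have bound: "\<bar>c * \<beta>' t - m * \<beta> t\<bar> \<le> (N * K) * exp (- \<mu> * t)" if "t \<ge> 0" "\<bar>c\<bar> + \<bar>m\<bar> \<le> N" for t c m
  proof -
    have "\<bar>c * \<beta>' t - m * \<beta> t\<bar> \<le> \<bar>c\<bar> * \<bar>\<beta>' t\<bar> + \<bar>m\<bar> * \<bar>\<beta> t\<bar>"
      by (rule order_trans[OF abs_triangle_ineq4]) (simp add: abs_mult)
    also have "\<dots> \<le> \<bar>c\<bar> * (K * exp (- \<mu> * t)) + \<bar>m\<bar> * (K * exp (- \<mu> * t))"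
      using that by (intro add_mono mult_left_mono bd) auto
    also have "\<dots> = (\<bar>c\<bar> + \<bar>m\<bar>) * (K * exp (- \<mu> * t))" by (simp add: algebra_simps)
    also have "\<dots> \<le> N * (K * exp (- \<mu> * t))" using that K by (intro mult_right_mono) auto
    finally show ?thesis by simp
  qed
  have eb: "\<bar>e11 t\<bar> \<le> (N * K) * exp (- \<mu> * t)" "\<bar>e12 t\<bar> \<le> (N * K) * exp (- \<mu> * t)"
    "\<bar>e21 t\<bar> \<le> (N * K) * exp (- \<mu> * t)" "\<bar>e22 t\<bar> \<le> (N * K) * exp (- \<mu> * t)" if "t \<ge> 0" for t
  proof -
    have N: "\<bar>1\<bar> + \<bar>m22\<bar> \<le> N" "\<bar>0\<bar> + \<bar>- m12\<bar> \<le> N" "\<bar>0\<bar> + \<bar>- m21\<bar> \<le> N" "\<bar>1\<bar> + \<bar>m11\<bar> \<le> N"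
      by (simp_all add: N_def)
    have e: "e11 t = 1 * \<beta>' t - m22 * \<beta> t" "e12 t = 0 * \<beta>' t - (- m12) * \<beta> t"
      "e21 t = 0 * \<beta>' t - (- m21) * \<beta> t" "e22 t = 1 * \<beta>' t - m11 * \<beta> t"
      by (simp_all add: e11_def e12_def e21_def e22_def)
    show "\<bar>e11 t\<bar> \<le> (N * K) * exp (- \<mu> * t)" "\<bar>e12 t\<bar> \<le> (N * K) * exp (- \<mu> * t)"
      "\<bar>e21 t\<bar> \<le> (N * K) * exp (- \<mu> * t)" "\<bar>e22 t\<bar> \<le> (N * K) * exp (- \<mu> * t)"
      unfolding e by (rule bound[OF that N(1)] bound[OF that N(2)] bound[OF that N(3)] bound[OF that N(4)])+
  qed
  define D where "D = (\<bar>l1\<bar> + \<bar>l2\<bar>) * exp (\<mu> * \<tau>)"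
  define \<kappa> where "\<kappa> = 2 * (N * K)\<^sup>2 * (4 + 2 * D\<^sup>2 * \<tau>)"
  have NK: "N * K > 0" using K by (auto simp: N_def intro!: mult_pos_pos add_pos_nonneg)
  show thesis
  proof (rule that)
    show "\<kappa> > 0" using zero_less_power[OF NK, of 2] \<tau> unfolding \<kappa>_def 
      by (intro mult_pos_pos add_pos_nonneg mult_nonneg_nonneg) auto
    show "2 * \<mu> > 0" using \<mu> by simp
    fix \<xi>1 \<xi>2 \<zeta> T
    assume x1: "caratheodory_deriv \<xi>1 (\<lambda>t. m11 * \<xi>1 t + m12 * \<xi>2 t + l1 * \<zeta> t)"
      and x2: "caratheodory_deriv \<xi>2 (\<lambda>t. m21 * \<xi>1 t + m22 * \<xi>2 t + l2 * \<zeta> t)" and T: "T \<ge> 0"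
      and m: "set_borel_measurable borel {0..T} \<zeta>" and i: "set_integrable lborel {0..T} (\<lambda>t. (\<zeta> t)\<^sup>2)"
      and late: "AE t in lborel. t \<in> {\<tau><..T} \<longrightarrow> \<zeta> t = 0"
    define n I S where "n = \<bar>\<xi>1 0\<bar> + \<bar>\<xi>2 0\<bar>" and "I = (LBINT t:{0..T}. \<bar>\<zeta> t\<bar>)"
      and "S = (LBINT t:{0..T}. (\<zeta> t)\<^sup>2)"
    have i1: "set_integrable lborel {0..T} \<zeta>" by (rule square_integrable_imp_integrable[OF m i])
    have "\<bar>\<xi>1 T\<bar> \<le> (N * K) * exp (- \<mu> * T) * (n + D * I)"
      using forced_mode_bound[OF x1 x2 d(1) d(2) eb(1) eb(2) _ T i1 late] \<mu> \<beta>0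
      by (simp add: e11_def e12_def n_def D_def I_def)
    moreover have "\<bar>\<xi>2 T\<bar> \<le> (N * K) * exp (- \<mu> * T) * (n + D * I)"
      using forced_mode_bound[OF x1 x2 d(3) d(4) eb(3) eb(4) _ T i1 late] \<mu> \<beta>0
      by (simp add: e21_def e22_def n_def D_def I_def)
    ultimately have "(\<xi>1 T)\<^sup>2 + (\<xi>2 T)\<^sup>2 \<le> 2 * ((N * K) * exp (- \<mu> * T) * (n + D * I))\<^sup>2"
      using power_mono[of "\<bar>\<xi>1 T\<bar>" "(N * K) * exp (- \<mu> * T) * (n + D * I)" 2]
        power_mono[of "\<bar>\<xi>2 T\<bar>" "(N * K) * exp (- \<mu> * T) * (n + D * I)" 2] by simp
    also have "\<dots> = 2 * (N * K)\<^sup>2 * exp (- (2 * \<mu>) * T) * (n + D * I)\<^sup>2"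
    proof -
      have "(exp (- \<mu> * T))\<^sup>2 = exp (- (2 * \<mu>) * T)"
        by (simp add: power2_eq_square exp_add[symmetric])
      then show ?thesis by (simp only: power_mult_distrib mult.assoc)
    qed
    also have "\<dots> \<le> 2 * (N * K)\<^sup>2 * exp (- (2 * \<mu>) * T) * ((4 + 2 * D\<^sup>2 * \<tau>) * ((\<xi>1 0)\<^sup>2 + (\<xi>2 0)\<^sup>2 + S))"
    proof (rule mult_left_mono)
      have sq: "(p + q)\<^sup>2 \<le> 2 * p\<^sup>2 + 2 * q\<^sup>2" for p q :: real
        using zero_le_power2[of "p - q"] by (simp add: power2_eq_square algebra_simps)
      have S0: "S \<ge> 0" unfolding S_def by (simp add: set_lebesgue_integral_def)
      have "n\<^sup>2 \<le> 2 * ((\<xi>1 0)\<^sup>2 + (\<xi>2 0)\<^sup>2)"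
        using sq[of "\<bar>\<xi>1 0\<bar>" "\<bar>\<xi>2 0\<bar>"] by (simp add: n_def)
      moreover have "(D * I)\<^sup>2 \<le> D\<^sup>2 * (\<tau> * S)"
        unfolding power_mult_distrib I_def S_def
        by (intro mult_left_mono integral_abs_square_le[OF \<tau> m i late]) auto
      ultimately have "(n + D * I)\<^sup>2 \<le> 4 * ((\<xi>1 0)\<^sup>2 + (\<xi>2 0)\<^sup>2) + 2 * D\<^sup>2 * \<tau> * S"
        using sq[of n "D * I"] by linarith
      also have "\<dots> \<le> (4 + 2 * D\<^sup>2 * \<tau>) * ((\<xi>1 0)\<^sup>2 + (\<xi>2 0)\<^sup>2 + S)"
      proof -
        have "0 \<le> 2 * D\<^sup>2 * \<tau> * ((\<xi>1 0)\<^sup>2 + (\<xi>2 0)\<^sup>2)" using \<tau> by (intro mult_nonneg_nonneg add_nonneg_nonneg) auto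
        moreover have "(4 + 2 * D\<^sup>2 * \<tau>) * ((\<xi>1 0)\<^sup>2 + (\<xi>2 0)\<^sup>2 + S) =
            4 * ((\<xi>1 0)\<^sup>2 + (\<xi>2 0)\<^sup>2) + 2 * D\<^sup>2 * \<tau> * ((\<xi>1 0)\<^sup>2 + (\<xi>2 0)\<^sup>2) + 4 * S + 2 * D\<^sup>2 * \<tau> * S"
          by (simp only: distrib_left distrib_right add_ac)
        ultimately show ?thesis using S0 by linarith
      qed
      finally show "(n + D * I)\<^sup>2 \<le> (4 + 2 * D\<^sup>2 * \<tau>) * ((\<xi>1 0)\<^sup>2 + (\<xi>2 0)\<^sup>2 + S)" .
    qed simp
    finally show "(\<xi>1 T)\<^sup>2 + (\<xi>2 T)\<^sup>2 \<le> \<kappa> * exp (- (2 * \<mu>) * T) * ((\<xi>1 0)\<^sup>2 + (\<xi>2 0)\<^sup>2 + (LBINT t:{0..T}. (\<zeta> t)\<^sup>2))"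
      by (simp add: \<kappa>_def S_def mult_ac)
  qed
qed

section \<open>Weak transport equations tested along characteristics\<close>

text \<open>For \<open>\<phi>(x,t) = g (x + b t)\<close> one has \<open>\<phi>\<^sub>t - b \<phi>\<^sub>x = 0\<close>, so the space-time integral of \<open>w\<close> drops out of the weak equation.\<close>

lemma weak_transport_along_characteristics:
  assumes w: "weak_transport b f w" and g: "C1_real g g'" and T: "T \<ge> 0"
  shows "(LBINT x:{0..1}. w x T * g (x + b * T)) - (LBINT x:{0..1}. w x 0 * g x) =
    (LBINT t:{0..T}. (LBINT x:{0..1}. f x t * g (x + b * t))) +
    b * (LBINT t:{0..T}. w 1 t * g (1 + b * t) - w 0 t * g (b * t))"
proof -
  have gd: "(g has_real_derivative g' s) (at s)" for s using g by (simp add: C1_real_def)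
  have gc: "continuous_on UNIV g'" using g by (simp add: C1_real_def)
  have "C1_test (\<lambda>x t. g (x + b * t)) (\<lambda>x t. g' (x + b * t)) (\<lambda>x t. b * g' (x + b * t))"
    unfolding C1_test_def
  proof (intro conjI allI)
    show "((\<lambda>y. g (y + b * t)) has_real_derivative g' (x + b * t)) (at x)" for x t
      by (rule DERIV_cong[OF DERIV_chain2[OF gd]]) (auto intro!: derivative_eq_intros)
    show "((\<lambda>t. g (x + b * t)) has_real_derivative b * g' (x + b * t)) (at t)" for x t
      by (rule DERIV_cong[OF DERIV_chain2[OF gd]]) (auto intro!: derivative_eq_intros)
    show "continuous_on UNIV (\<lambda>(x, t). g' (x + b * t))" "continuous_on UNIV (\<lambda>(x, t). b * g' (x + b * t))"
      unfolding case_prod_beta by (intro continuous_intros continuous_on_compose2[OF gc]; simp)+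
  qed
  then show ?thesis using w T unfolding weak_transport_def by fastforce
qed

lemma trace_measurable:
  assumes w: "transport_regular w" and x: "x \<in> {0..1}"
  shows "set_borel_measurable borel {0..T} (w x)"
proof -
  have m: "(\<lambda>p. indicator ({0..1} \<times> {0..}) p *\<^sub>R (\<lambda>(x, t). w x t) p) \<in> borel_measurable borel"
    using w by (simp add: transport_regular_def set_borel_measurable_def)
  have "(\<lambda>t. (x, t)) \<in> borel_measurable borel"
    by (intro borel_measurable_continuous_onI continuous_intros)
  from measurable_compose[OF this m]
  have "(\<lambda>t. indicator {0..} t * w x t) \<in> borel_measurable borel"
    using x by (simp add: indicator_times)
  then have "(\<lambda>t. indicator {0..T} t * (indicator {0..} t * w x t)) \<in> borel_measurable borel"
    by (rule borel_measurable_times[rotated]) measurable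
  moreover have "(\<lambda>t. indicator {0..T} t * (indicator {0..} t * w x t)) = (\<lambda>t. indicator {0..T} t * w x t)"
    by (auto simp: indicator_def)
  ultimately show ?thesis by (simp add: set_borel_measurable_def)
qed

lemma trace_L2:
  assumes "transport_regular w" "T \<ge> 0"
  shows "L2_Icc 0 T (w 0)" "L2_Icc 0 T (w 1)"
  using assms trace_measurable[OF assms(1), of 0 T] trace_measurable[OF assms(1), of 1 T]
  by (auto simp: L2_Icc_def transport_regular_def L2_loc_time_def)

lemma profile_L2: "transport_regular w \<Longrightarrow> t \<ge> 0 \<Longrightarrow> L2_Icc 0 1 (\<lambda>x. w x t)"
  by (simp add: transport_regular_def L2_unit_iff)

section \<open>Moments of the backstepping kernels\<close>

definition moment :: "real \<Rightarrow> (real \<Rightarrow> real) \<Rightarrow> (real \<Rightarrow> real) \<Rightarrow> real \<Rightarrow> real" where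
  "moment b g \<gamma> t = (LBINT x:{0..1}. \<gamma> x * g (x + b * t))"

lemma moment_integrable:
  fixes g \<gamma> :: "real \<Rightarrow> real"
  assumes "continuous_on UNIV g" "continuous_on UNIV \<gamma>"
  shows "set_integrable lborel {0..1} (\<lambda>x. \<gamma> x * g (x + b * t))"
  by (intro borel_integrable_atLeastAtMost' continuous_intros continuous_on_compose2[OF assms(1)]
      continuous_on_subset[OF assms(2)]) auto

lemma moment_lincomb:
  assumes "continuous_on UNIV g" "continuous_on UNIV \<gamma>" "continuous_on UNIV \<delta>"
  shows "moment b g (\<lambda>x. p * \<gamma> x + q * \<delta> x) t = p * moment b g \<gamma> t + q * moment b g \<delta> t"
proof -
  have "moment b g (\<lambda>x. p * \<gamma> x + q * \<delta> x) t =
      (LBINT x:{0..1}. p * (\<gamma> x * g (x + b * t)) + q * (\<delta> x * g (x + b * t)))"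
    unfolding moment_def by (simp add: algebra_simps)
  also have "\<dots> = p * moment b g \<gamma> t + q * moment b g \<delta> t"
    unfolding moment_def using moment_integrable[OF assms(1,2)] moment_integrable[OF assms(1,3)]
    by (subst set_integral_add) auto
  finally show ?thesis .
qed

lemma moment_has_derivative:
  assumes g: "C1_real g g'" and \<gamma>: "continuous_on UNIV \<gamma>"
  shows "(moment b g \<gamma> has_real_derivative b * moment b g' \<gamma> t) (at t)"
proof -
  have gd: "(g has_real_derivative g' s) (at s)" for s using g by (simp add: C1_real_def)
  have gc: "continuous_on UNIV g'" using g by (simp add: C1_real_def)
  have g0: "continuous_on UNIV g" by (rule C1_real_continuous[OF g])
  have eq: "moment b h \<gamma> t = integral (cbox 0 1) (\<lambda>x. \<gamma> x * h (x + b * t))" 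
    if "continuous_on UNIV h" for h t
    unfolding moment_def using set_borel_integral_eq_integral(2)[OF moment_integrable[OF that \<gamma>]]
    by simp
  have "((\<lambda>t. integral (cbox 0 1) (\<lambda>x. \<gamma> x * g (x + b * t))) has_real_derivative
      integral (cbox 0 1) (\<lambda>x. \<gamma> x * (b * g' (x + b * t)))) (at t within UNIV)"
  proof (rule leibniz_rule_field_derivative)
    show "((\<lambda>t. \<gamma> x * g (x + b * t)) has_real_derivative \<gamma> x * (b * g' (x + b * t))) (at t within UNIV)" for t x
      by (rule DERIV_cmult) (rule DERIV_cong[OF DERIV_chain2[OF gd]], auto intro!: derivative_eq_intros)
    show "(\<lambda>x. \<gamma> x * g (x + b * t)) integrable_on cbox 0 1" for t
      using set_borel_integral_eq_integral(1)[OF moment_integrable[OF g0 \<gamma>]] by simp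
    show "continuous_on (UNIV \<times> cbox 0 1) (\<lambda>(t, x). \<gamma> x * (b * g' (x + b * t)))"
      unfolding case_prod_beta
      by (intro continuous_intros continuous_on_compose2[OF gc] continuous_on_compose2[OF \<gamma>]) auto
  qed auto
  moreover have "integral (cbox 0 1) (\<lambda>x. \<gamma> x * (b * g' (x + b * t))) = b * moment b g' \<gamma> t"
    unfolding eq[OF gc] by (simp add: mult.left_commute)
  ultimately show ?thesis by (simp add: eq[OF g0, abs_def])
qed

lemma moment_continuous:
  assumes g: "C1_real g g'" and \<gamma>: "continuous_on UNIV \<gamma>"
  shows "continuous_on S (moment b g \<gamma>)"
  using moment_has_derivative[OF assms] by (meson DERIV_isCont continuous_at_imp_continuous_on)

lemma moment_integration_by_parts:
  assumes g: "C1_real g g'" and \<gamma>: "C1_real \<gamma> \<gamma>'"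
  shows "moment b g' \<gamma> t = \<gamma> 1 * g (1 + b * t) - \<gamma> 0 * g (b * t) - moment b g \<gamma>' t"
proof -
  have d: "(g has_real_derivative g' s) (at s)" "(\<gamma> has_real_derivative \<gamma>' s) (at s)" for s
    using g \<gamma> by (simp_all add: C1_real_def)
  have c: "continuous_on UNIV g'" "continuous_on UNIV \<gamma>'" "continuous_on UNIV g" "continuous_on UNIV \<gamma>"
    using g \<gamma> by (simp_all add: C1_real_def C1_real_continuous[OF g] C1_real_continuous[OF \<gamma>])
  note i = moment_integrable[OF c(1,4), of b t] moment_integrable[OF c(3,2), of b t]
  have dp: "((\<lambda>x. \<gamma> x * g (x + b * t)) has_real_derivative \<gamma> x * g' (x + b * t) + \<gamma>' x * g (x + b * t)) (at x within S)" for x S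
    by (rule DERIV_cong[OF DERIV_mult[OF has_field_derivative_at_within[OF d(2)] DERIV_chain2[OF d(1)]]])
       (auto intro!: derivative_eq_intros)
  have "(LBINT x:{0..1}. \<gamma> x * g' (x + b * t) + \<gamma>' x * g (x + b * t)) = \<gamma> 1 * g (1 + b * t) - \<gamma> 0 * g (0 + b * t)"
    by (intro LBINT_FTC dp continuous_intros continuous_on_compose2[OF c(1)] continuous_on_compose2[OF c(2)]
        continuous_on_compose2[OF c(3)] continuous_on_compose2[OF c(4)]) auto
  moreover have "(LBINT x:{0..1}. \<gamma> x * g' (x + b * t) + \<gamma>' x * g (x + b * t)) = moment b g' \<gamma> t + moment b g \<gamma>' t"
    unfolding moment_def using i by (rule set_integral_add(2))
  ultimately show ?thesis by simp
qed

lemma \<gamma>\<^sub>1_C1: "C1_real (\<gamma>\<^sub>1 a b bX) (\<lambda>x. bX / a * (- (a / b) * exp (- (a / b) * x)))"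
proof -
  have "C1_real (\<lambda>x. A * (exp (c * x) - 1)) (\<lambda>x. A * (c * exp (c * x)))" for A c :: real
    unfolding C1_real_def by (auto intro!: derivative_eq_intros continuous_intros)
  from this[of "bX / a" "- (a / b)"] show ?thesis by (simp add: \<gamma>\<^sub>1_def[abs_def])
qed

lemma \<gamma>\<^sub>2_C1: "C1_real (\<gamma>\<^sub>2 a b bX) (\<lambda>x. - (bX / (b * a)) + bX / a\<^sup>2 * (a / b * exp (- (a / b) * x)))"
proof -
  have "C1_real (\<lambda>x. D * x + A * (1 - exp (c * x))) (\<lambda>x. D + A * (- c * exp (c * x)))" for A D c :: real
    unfolding C1_real_def by (auto intro!: derivative_eq_intros continuous_intros)
  from this[of "- (bX / (b * a))" "bX / a\<^sup>2" "- (a / b)"] show ?thesis by (simp add: \<gamma>\<^sub>2_def[abs_def])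
qed

lemma \<gamma>_continuous: "continuous_on S (\<gamma>\<^sub>1 a b bX)" "continuous_on S (\<gamma>\<^sub>2 a b bX)"
  by (rule C1_real_continuous[OF \<gamma>\<^sub>1_C1] C1_real_continuous[OF \<gamma>\<^sub>2_C1])+

text \<open>The dual form of the boundary value problem \<open>b \<gamma>\<^sub>1' = - a \<gamma>\<^sub>1 - b\<^sub>X\<close>, \<open>\<gamma>\<^sub>1 0 = 0\<close>.\<close>

lemma moment_\<gamma>\<^sub>1_derivative:
  assumes g: "C1_real g g'" and ab: "a \<noteq> 0" "b \<noteq> 0"
  shows "(moment b g (\<gamma>\<^sub>1 a b bX) has_real_derivative
    b * \<gamma>\<^sub>1 a b bX 1 * g (1 + b * t) + a * moment b g (\<gamma>\<^sub>1 a b bX) t + bX * moment b g (\<lambda>_. 1) t) (at t)"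
proof (rule DERIV_cong[OF moment_has_derivative[OF g \<gamma>_continuous(1)]])
  have d: "(\<lambda>x. bX / a * (- (a / b) * exp (- (a / b) * x))) = (\<lambda>x. (- (a / b)) * \<gamma>\<^sub>1 a b bX x + (- (bX / b)) * 1)"
    using ab by (simp add: fun_eq_iff \<gamma>\<^sub>1_def field_simps)
  have m: "moment b g (\<lambda>x. (- (a / b)) * \<gamma>\<^sub>1 a b bX x + (- (bX / b)) * 1) t = 
    (- (a / b)) * moment b g (\<gamma>\<^sub>1 a b bX) t + (- (bX / b)) * moment b g (\<lambda>_. 1) t"
    by (intro moment_lincomb C1_real_continuous[OF g] \<gamma>_continuous continuous_intros)
  have "\<gamma>\<^sub>1 a b bX 0 = 0" by (simp add: \<gamma>\<^sub>1_def)
  then show "b * moment b g' (\<gamma>\<^sub>1 a b bX) t = b * \<gamma>\<^sub>1 a b bX 1 * g (1 + b * t) + a * moment b g (\<gamma>\<^sub>1 a b bX) t + bX * moment b g (\<lambda>_. 1) t"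
    unfolding moment_integration_by_parts[OF g \<gamma>\<^sub>1_C1] d m using ab by (simp add: field_simps)
qed

text \<open>The dual form of the boundary value problem \<open>b \<gamma>\<^sub>2' = \<gamma>\<^sub>1\<close>, \<open>\<gamma>\<^sub>2 0 = 0\<close>.\<close>

lemma moment_\<gamma>\<^sub>2_derivative:
  assumes g: "C1_real g g'" and ab: "a \<noteq> 0" "b \<noteq> 0"
  shows "(moment b g (\<gamma>\<^sub>2 a b bX) has_real_derivative
    b * \<gamma>\<^sub>2 a b bX 1 * g (1 + b * t) - moment b g (\<gamma>\<^sub>1 a b bX) t) (at t)"
proof (rule DERIV_cong[OF moment_has_derivative[OF g \<gamma>_continuous(2)]])
  have d: "(\<lambda>x. - (bX / (b * a)) + bX / a\<^sup>2 * (a / b * exp (- (a / b) * x))) = (\<lambda>x. (1 / b) * \<gamma>\<^sub>1 a b bX x + 0 * 1)"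
    using ab by (simp add: fun_eq_iff \<gamma>\<^sub>1_def field_simps power2_eq_square)
  have m: "moment b g (\<lambda>x. (1 / b) * \<gamma>\<^sub>1 a b bX x + 0 * 1) t = 
    (1 / b) * moment b g (\<gamma>\<^sub>1 a b bX) t + 0 * moment b g (\<lambda>_. 1) t"
    by (intro moment_lincomb C1_real_continuous[OF g] \<gamma>_continuous continuous_intros)
  have "\<gamma>\<^sub>2 a b bX 0 = 0" by (simp add: \<gamma>\<^sub>2_def)
  then show "b * moment b g' (\<gamma>\<^sub>2 a b bX) t = b * \<gamma>\<^sub>2 a b bX 1 * g (1 + b * t) - moment b g (\<gamma>\<^sub>1 a b bX) t"
    unfolding moment_integration_by_parts[OF g \<gamma>\<^sub>2_C1] d m using ab by (simp add: field_simps)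
qed

section \<open>The observer error and its backstepping transform\<close>

text \<open>The difference of the weak equations of plant and observer.  Most of the proof is integrability: the integral
  of a difference splits only for integrable terms.\<close>

lemma error_characteristic_identity:
  assumes plant: "plant_solution a b bX Ue U u X V"
    and obs: "observer_solution a b bX Ue L1 L2 U u uh Xh Vh"
    and g: "C1_real g g'" and T: "T \<ge> 0"
  shows "(LBINT x:{0..1}. (u x T - uh x T) * g (x + b * T)) - (LBINT x:{0..1}. (u x 0 - uh x 0) * g x) =
    (LBINT t:{0..T}. bX * (X t - Xh t) * moment b g (\<lambda>_. 1) t
        - (u 1 t - uh 1 t) * (L1 * moment b g (\<gamma>\<^sub>1 a b bX) t + L2 * moment b g (\<gamma>\<^sub>2 a b bX) t)) +
    b * (LBINT t:{0..T}. (u 1 t - uh 1 t) * g (1 + b * t))"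
proof -
  define m0 m1 m2 where "m0 = moment b g (\<lambda>_. 1)" and "m1 = moment b g (\<gamma>\<^sub>1 a b bX)"
    and "m2 = moment b g (\<gamma>\<^sub>2 a b bX)"
  define y where "y t = u 1 t - uh 1 t" for t
  have wu: "weak_transport b (\<lambda>x t. bX * X t) u"
    and wuh: "weak_transport b (\<lambda>x t. bX * Xh t + inj_gain a b bX L1 L2 x * (u 1 t - uh 1 t)) uh"
    and bu: "AE t in lborel. t \<ge> 0 \<longrightarrow> u 0 t = 2 * Ue - U t"
    and buh: "AE t in lborel. t \<ge> 0 \<longrightarrow> uh 0 t = - U t + 2 * Ue"
    and Xd: "\<And>t. t \<ge> 0 \<Longrightarrow> (X has_real_derivative (- a * X t + V t)) (at t within {0..})"
    and Xh: "caratheodory_deriv Xh (\<lambda>t. - a * Xh t + Vh t + L1 * (u 1 t - uh 1 t))"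
    using plant obs by (auto simp: plant_solution_def observer_solution_def)
  have ru: "transport_regular u" "transport_regular uh"
    using wu wuh by (auto simp: weak_transport_def)
  have gc: "continuous_on UNIV g" by (rule C1_real_continuous[OF g])
  note gcomp = continuous_on_compose2[OF gc]
  have mc: "continuous_on S m0" "continuous_on S m1" "continuous_on S m2" for S
    unfolding m0_def m1_def m2_def by (intro moment_continuous[OF g] \<gamma>_continuous continuous_intros)+
  have Xc: "continuous_on {0..T} X"
    using DERIV_continuous_on[of "{0..}" X, OF Xd] by (rule continuous_on_subset) auto
  have Xhc: "continuous_on {0..T} Xh" by (rule caratheodory_deriv_continuous[OF Xh])
  have iu: "set_integrable lborel {0..T} (u 0)" "set_integrable lborel {0..T} (u 1)"
    "set_integrable lborel {0..T} (uh 0)" "set_integrable lborel {0..T} (uh 1)"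
    using trace_L2[OF ru(1) T] trace_L2[OF ru(2) T] by (auto intro: L2_Icc_integrable)
  then have iy: "set_integrable lborel {0..T} y" unfolding y_def by (intro set_integral_diff)
  have bd: "(LBINT t:{0..T}. w 1 t * g (1 + b * t) - w 0 t * g (b * t)) =
      (LBINT t:{0..T}. w 1 t * g (1 + b * t)) - (LBINT t:{0..T}. w 0 t * g (b * t))"
    if "set_integrable lborel {0..T} (w 0)" "set_integrable lborel {0..T} (w 1)" for w
    using that by (intro set_integral_diff set_integrable_mult_continuous gcomp continuous_intros) auto
  \<comment> \<open>Plant and observer are fed with the same boundary value, so the inflow of the error vanishes.\<close>
  have inflow: "(LBINT t:{0..T}. u 0 t * g (b * t)) = (LBINT t:{0..T}. uh 0 t * g (b * t))"
  proof -
    have "(LBINT t:{0..T}. u 0 t * g (b * t)) - (LBINT t:{0..T}. uh 0 t * g (b * t)) =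
        (LBINT t:{0..T}. u 0 t * g (b * t) - uh 0 t * g (b * t))"
      by (rule set_integral_diff(2)[symmetric])
         (intro set_integrable_mult_continuous iu gcomp continuous_intros; simp)+
    also have "\<dots> = 0"
      unfolding set_lebesgue_integral_def
    proof (rule integral_eq_zero_AE)
      show "AE t in lborel. indicator {0..T} t *\<^sub>R (u 0 t * g (b * t) - uh 0 t * g (b * t)) = 0"
        using bu buh by eventually_elim (auto simp: indicator_def)
    qed
    finally show ?thesis by simp
  qed
  have outflow: "(LBINT t:{0..T}. u 1 t * g (1 + b * t)) - (LBINT t:{0..T}. uh 1 t * g (1 + b * t)) =
      (LBINT t:{0..T}. y t * g (1 + b * t))"
    unfolding y_def left_diff_distrib
    by (rule set_integral_diff(2)[symmetric])
       (intro set_integrable_mult_continuous iu gcomp continuous_intros; simp)+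
  have profile: "(LBINT x:{0..1}. u x t * h x) - (LBINT x:{0..1}. uh x t * h x) =
      (LBINT x:{0..1}. (u x t - uh x t) * h x)" if "t \<ge> 0" "continuous_on {0..1} h" for t h
    unfolding left_diff_distrib
    by (rule set_integral_diff(2)[symmetric])
       (intro set_integrable_mult_continuous L2_Icc_integrable profile_L2 ru that)+
  have fu: "(LBINT x:{0..1}. bX * X t * g (x + b * t)) = bX * X t * m0 t" for t
    by (simp add: m0_def moment_def)
  have fuh: "(LBINT x:{0..1}. (bX * Xh t + inj_gain a b bX L1 L2 x * (u 1 t - uh 1 t)) * g (x + b * t)) =
      bX * Xh t * m0 t + y t * (L1 * m1 t + L2 * m2 t)" for t
  proof -
    have "bX * Xh t + inj_gain a b bX L1 L2 x * (u 1 t - uh 1 t) =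
        bX * Xh t * 1 + y t * (L1 * \<gamma>\<^sub>1 a b bX x + L2 * \<gamma>\<^sub>2 a b bX x)" for x
      by (simp add: inj_gain_def y_def mult.commute)
    then have "(LBINT x:{0..1}. (bX * Xh t + inj_gain a b bX L1 L2 x * (u 1 t - uh 1 t)) * g (x + b * t)) =
        moment b g (\<lambda>x. bX * Xh t * 1 + y t * (L1 * \<gamma>\<^sub>1 a b bX x + L2 * \<gamma>\<^sub>2 a b bX x)) t"
      unfolding moment_def by (simp only:)
    also have "\<dots> = bX * Xh t * m0 t + y t * moment b g (\<lambda>x. L1 * \<gamma>\<^sub>1 a b bX x + L2 * \<gamma>\<^sub>2 a b bX x) t"
      unfolding m0_def by (intro moment_lincomb gc \<gamma>_continuous continuous_intros)
    also have "moment b g (\<lambda>x. L1 * \<gamma>\<^sub>1 a b bX x + L2 * \<gamma>\<^sub>2 a b bX x) t = L1 * m1 t + L2 * m2 t"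
      unfolding m1_def m2_def by (intro moment_lincomb gc \<gamma>_continuous)
    finally show ?thesis .
  qed
  have if1: "set_integrable lborel {0..T} (\<lambda>t. bX * X t * m0 t)"
    by (intro borel_integrable_atLeastAtMost' continuous_intros mc Xc)
  have if2: "set_integrable lborel {0..T} (\<lambda>t. bX * Xh t * m0 t + y t * (L1 * m1 t + L2 * m2 t))"
    by (intro set_integral_add set_integrable_mult_continuous iy borel_integrable_atLeastAtMost' continuous_intros mc Xhc)
  have source: "(LBINT t:{0..T}. bX * X t * m0 t) - (LBINT t:{0..T}. bX * Xh t * m0 t + y t * (L1 * m1 t + L2 * m2 t)) =
      (LBINT t:{0..T}. bX * (X t - Xh t) * m0 t - y t * (L1 * m1 t + L2 * m2 t))"
    by (subst set_integral_diff(2)[symmetric, OF if1 if2]) (simp add: algebra_simps)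
  have c1: "continuous_on {0..1} (\<lambda>x. g (x + b * T))" "continuous_on {0..1} g"
    by (intro gcomp continuous_intros) (auto intro: C1_real_continuous[OF g])
  have zero: "(0::real) \<le> 0" by simp
  have "(LBINT x:{0..1}. (u x T - uh x T) * g (x + b * T)) - (LBINT x:{0..1}. (u x 0 - uh x 0) * g x) =
    ((LBINT t:{0..T}. bX * X t * m0 t) - (LBINT t:{0..T}. bX * Xh t * m0 t + y t * (L1 * m1 t + L2 * m2 t))) +
    b * ((LBINT t:{0..T}. u 1 t * g (1 + b * t)) - (LBINT t:{0..T}. uh 1 t * g (1 + b * t)))"
    using weak_transport_along_characteristics[OF wu g T] weak_transport_along_characteristics[OF wuh g T] inflow
    unfolding fu fuh bd[OF iu(1,2)] bd[OF iu(3,4)] profile[OF T c1(1), symmetric] profile[OF zero c1(2), symmetric]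
    by (simp add: algebra_simps)
  then show ?thesis
    unfolding source outflow unfolding m0_def m1_def m2_def y_def .
qed

text \<open>Subtracting the product rules for the two terms \<open>\<gamma>\<^sub>i \<xi>\<^sub>i\<close> cancels the whole source of the error equation, the
  injection because \<open>p = L\<^sub>1 \<gamma>\<^sub>1 + L\<^sub>2 \<gamma>\<^sub>2\<close>.  The result has the form required by \<open>transport_energy\<close>.\<close>

lemma backstepping_identity:
  assumes X: "caratheodory_deriv X (\<lambda>t. - a * X t + V t - L1 * y t)"
    and V: "caratheodory_deriv V (\<lambda>t. - (L2 * y t))"
    and y: "set_integrable lborel {0..T} y" and ab: "a \<noteq> 0" "b \<noteq> 0"
    and w: "set_integrable lborel {0..1} w0" "set_integrable lborel {0..1} wT"
    and g: "C1_real g g'" and T: "T \<ge> 0"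
    and weak: "(LBINT x:{0..1}. wT x * g (x + b * T)) - (LBINT x:{0..1}. w0 x * g x) =
      (LBINT t:{0..T}. bX * X t * moment b g (\<lambda>_. 1) t
        - y t * (L1 * moment b g (\<gamma>\<^sub>1 a b bX) t + L2 * moment b g (\<gamma>\<^sub>2 a b bX) t)) +
      b * (LBINT t:{0..T}. y t * g (1 + b * t))"
  shows "(LBINT x:{0..1}. (wT x - (\<gamma>\<^sub>1 a b bX x * X T + \<gamma>\<^sub>2 a b bX x * V T)) * g (x + b * T)) -
      (LBINT x:{0..1}. (w0 x - (\<gamma>\<^sub>1 a b bX x * X 0 + \<gamma>\<^sub>2 a b bX x * V 0)) * g x) =
      b * (LBINT t:{0..T}. (y t - (\<gamma>\<^sub>1 a b bX 1 * X t + \<gamma>\<^sub>2 a b bX 1 * V t)) * g (1 + b * t))"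
proof -
  define m0 m1 m2 where "m0 = moment b g (\<lambda>_. 1)" and "m1 = moment b g (\<gamma>\<^sub>1 a b bX)"
    and "m2 = moment b g (\<gamma>\<^sub>2 a b bX)"
  define c1 c2 where "c1 = \<gamma>\<^sub>1 a b bX 1" and "c2 = \<gamma>\<^sub>2 a b bX 1"
  define G where "G t = g (1 + b * t)" for t
  define d1 d2 where "d1 t = b * c1 * G t + a * m1 t + bX * m0 t" and "d2 t = b * c2 * G t - m1 t" for t
  have gc: "continuous_on UNIV g" by (rule C1_real_continuous[OF g])
  have Gc: "continuous_on S G" for S
    unfolding G_def by (intro continuous_on_compose2[OF gc] continuous_intros) auto
  have mc: "continuous_on S m0" "continuous_on S m1" "continuous_on S m2" for S
    unfolding m0_def m1_def m2_def by (intro moment_continuous[OF g] \<gamma>_continuous continuous_intros)+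
  have dc: "continuous_on S d1" "continuous_on S d2" for S
    unfolding d1_def d2_def by (intro continuous_intros mc Gc)+
  have der: "(m1 has_real_derivative d1 t) (at t within S)" "(m2 has_real_derivative d2 t) (at t within S)" for t S
    using moment_\<gamma>\<^sub>1_derivative[OF g ab, of bX t] moment_\<gamma>\<^sub>2_derivative[OF g ab, of bX t]
    by (auto simp: m0_def m1_def m2_def c1_def c2_def d1_def d2_def G_def intro: has_field_derivative_at_within)
  note XVc = caratheodory_deriv_continuous[OF X, of T] caratheodory_deriv_continuous[OF V, of T]
  have F: "set_integrable lborel {0..T} (\<lambda>t. - a * X t + V t - L1 * y t)" "set_integrable lborel {0..T} (\<lambda>t. - (L2 * y t))"
    by (rule caratheodory_derivD(1)[OF X T] caratheodory_derivD(1)[OF V T])+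
  have yG: "set_integrable lborel {0..T} (\<lambda>t. y t * G t)" by (intro set_integrable_mult_continuous y Gc)
  have cG: "set_integrable lborel {0..T} (\<lambda>t. (c1 * X t + c2 * V t) * G t)"
    by (intro borel_integrable_atLeastAtMost' continuous_intros XVc Gc)
  have i1: "set_integrable lborel {0..T} (\<lambda>t. d1 t * X t + (- a * X t + V t - L1 * y t) * m1 t)"
    by (intro set_integral_add set_integrable_mult_continuous[OF F(1)] borel_integrable_atLeastAtMost' continuous_intros dc XVc mc)
  have i2: "set_integrable lborel {0..T} (\<lambda>t. d2 t * V t + (- (L2 * y t)) * m2 t)"
    by (intro set_integral_add set_integrable_mult_continuous[OF F(2)] borel_integrable_atLeastAtMost' continuous_intros dc XVc mc)
  have i3: "set_integrable lborel {0..T} (\<lambda>t. bX * X t * m0 t - y t * (L1 * m1 t + L2 * m2 t))"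
    by (intro set_integral_diff set_integrable_mult_continuous y borel_integrable_atLeastAtMost' continuous_intros XVc mc)
  have "(m1 T * X T - m1 0 * X 0) + (m2 T * V T - m2 0 * V 0) =
      (LBINT t:{0..T}. (d1 t * X t + (- a * X t + V t - L1 * y t) * m1 t) + (d2 t * V t + (- (L2 * y t)) * m2 t))"
    unfolding caratheodory_product_rule[OF X T der(1) dc(1)] caratheodory_product_rule[OF V T der(2) dc(2)]
    using i1 i2 by (rule set_integral_add(2)[symmetric])
  also have "\<dots> = (LBINT t:{0..T}. (bX * X t * m0 t - y t * (L1 * m1 t + L2 * m2 t)) + b * ((c1 * X t + c2 * V t) * G t))"
    by (intro set_lebesgue_integral_cong) (auto simp: d1_def d2_def algebra_simps)
  also have "\<dots> = (LBINT t:{0..T}. bX * X t * m0 t - y t * (L1 * m1 t + L2 * m2 t)) + b * (LBINT t:{0..T}. (c1 * X t + c2 * V t) * G t)"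
    using i3 cG by (subst set_integral_add(2)) auto
  \<comment> \<open>The terms with \<open>m1 * X\<close> and \<open>m1 * V\<close> have cancelled because of the differential equations of the kernels;
  what is left is the source of the error equation and a boundary term at \<open>x = 1\<close>.\<close>
  finally have ode: "(m1 T * X T - m1 0 * X 0) + (m2 T * V T - m2 0 * V 0) = \<dots>" .
  have out: "(LBINT t:{0..T}. (y t - (c1 * X t + c2 * V t)) * G t) = (LBINT t:{0..T}. y t * G t) - (LBINT t:{0..T}. (c1 * X t + c2 * V t) * G t)"
    unfolding left_diff_distrib using yG cG by (rule set_integral_diff(2))
  have prof: "(LBINT x:{0..1}. (w x - (\<gamma>\<^sub>1 a b bX x * p + \<gamma>\<^sub>2 a b bX x * q)) * g (x + b * t)) =
      (LBINT x:{0..1}. w x * g (x + b * t)) - (m1 t * p + m2 t * q)" if "set_integrable lborel {0..1} w" for w p q t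
  proof -
    have "(LBINT x:{0..1}. (w x - (\<gamma>\<^sub>1 a b bX x * p + \<gamma>\<^sub>2 a b bX x * q)) * g (x + b * t)) =
      (LBINT x:{0..1}. w x * g (x + b * t)) - (LBINT x:{0..1}. (p * \<gamma>\<^sub>1 a b bX x + q * \<gamma>\<^sub>2 a b bX x) * g (x + b * t))"
      unfolding left_diff_distrib mult.commute[of _ p] mult.commute[of _ q]
      by (intro set_integral_diff(2) set_integrable_mult_continuous that moment_integrable gc \<gamma>_continuous
           continuous_intros continuous_on_compose2[OF gc]) auto
    also have "(LBINT x:{0..1}. (p * \<gamma>\<^sub>1 a b bX x + q * \<gamma>\<^sub>2 a b bX x) * g (x + b * t)) = p * m1 t + q * m2 t"
      using moment_lincomb[OF gc \<gamma>_continuous, where p=p and q=q and t=t and b=b]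
      by (simp add: moment_def m1_def m2_def)
    finally show ?thesis by (simp add: mult.commute)
  qed
  note prof0 = prof[OF w(1), where t=0, unfolded mult_zero_right add_0_right]
  show ?thesis
    unfolding c1_def[symmetric] c2_def[symmetric] G_def[symmetric] prof[OF w(2)] prof0 out right_diff_distrib
    using weak[folded m0_def m1_def m2_def G_def] ode by linarith
qed

text \<open>Used in both directions of the transformation, from \<open>w\<close> to \<open>z\<close> and back.\<close>

lemma square_integral_backstepping_le:
  assumes B: "\<And>x. x \<in> {0..1} \<Longrightarrow> \<bar>c1 x\<bar> \<le> B" "\<And>x. x \<in> {0..1} \<Longrightarrow> \<bar>c2 x\<bar> \<le> (B::real)"
    and f: "L2_Icc 0 1 f" and h: "L2_Icc 0 1 h"
    and eq: "\<And>x. x \<in> {0..1} \<Longrightarrow> h x = f x + (c1 x * p + c2 x * q)"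
  shows "(LBINT x:{0..1}. (h x)\<^sup>2) \<le> 3 * (LBINT x:{0..1}. (f x)\<^sup>2) + 3 * B\<^sup>2 * (p\<^sup>2 + q\<^sup>2)"
proof -
  have c: "set_integrable lborel {0..1} (\<lambda>x::real. c)" for c :: real
    by (intro borel_integrable_atLeastAtMost' continuous_intros)
  have i: "set_integrable lborel {0..1} (\<lambda>x. (f x)\<^sup>2)" "set_integrable lborel {0..1} (\<lambda>x. (h x)\<^sup>2)"
    using f h by (auto simp: L2_Icc_def)
  have pw: "(h x)\<^sup>2 \<le> 3 * (f x)\<^sup>2 + 3 * B\<^sup>2 * (p\<^sup>2 + q\<^sup>2)" if "x \<in> {0..1}" for x
  proof -
    have three: "(r + (s + t))\<^sup>2 \<le> 3 * r\<^sup>2 + 3 * s\<^sup>2 + 3 * t\<^sup>2" for r s t :: real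
      using zero_le_power2[of "r - s"] zero_le_power2[of "r - t"] zero_le_power2[of "s - t"]
      by (simp add: power2_eq_square algebra_simps)
    have "(c1 x)\<^sup>2 \<le> B\<^sup>2" "(c2 x)\<^sup>2 \<le> B\<^sup>2"
      using power_mono[OF B(1)[OF that], of 2] power_mono[OF B(2)[OF that], of 2] by simp_all
    then have "(c1 x * p)\<^sup>2 \<le> B\<^sup>2 * p\<^sup>2" "(c2 x * q)\<^sup>2 \<le> B\<^sup>2 * q\<^sup>2"
      unfolding power_mult_distrib by (intro mult_right_mono; simp)+
    with three[of "f x" "c1 x * p" "c2 x * q"] show ?thesis
      unfolding eq[OF that] distrib_left by linarith
  qed
  have "(LBINT x:{0..1}. (h x)\<^sup>2) \<le> (LBINT x:{0..1}. 3 * (f x)\<^sup>2 + 3 * B\<^sup>2 * (p\<^sup>2 + q\<^sup>2))"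
    by (rule set_integral_mono[OF i(2) set_integral_add(1)[OF set_integrable_mult_right c]]) (use i pw in auto)
  also have "\<dots> = 3 * (LBINT x:{0..1}. (f x)\<^sup>2) + 3 * B\<^sup>2 * (p\<^sup>2 + q\<^sup>2)"
    by (subst set_integral_add(2)[OF set_integrable_mult_right c]) (use i in \<open>auto simp: set_integral_const\<close>)
  finally show ?thesis .
qed

section \<open>The Hurwitz condition in coordinates\<close>

text \<open>A root of the characteristic polynomial of a matrix of order two is an eigenvalue: \<open>(m12, k - m11)\<close> or
  \<open>(k - m22, m21)\<close> is an eigenvector unless both vanish, and then the matrix is \<open>k\<close> times the identity.\<close>

lemma eigenvalue_2x2:
  fixes A :: "'a :: field mat"
  assumes A: "A \<in> carrier_mat 2 2"
    and root: "k\<^sup>2 - (A $$ (0,0) + A $$ (1,1)) * k + (A $$ (0,0) * A $$ (1,1) - A $$ (0,1) * A $$ (1,0)) = 0"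
  shows "eigenvalue A k"
proof -
  define m11 m12 m21 m22 where "m11 = A $$ (0,0)" and "m12 = A $$ (0,1)" and "m21 = A $$ (1,0)" and "m22 = A $$ (1,1)"
  have r: "(k - m11) * (k - m22) = m12 * m21"
    using root unfolding m11_def[symmetric] m12_def[symmetric] m21_def[symmetric] m22_def[symmetric]
    by (simp add: algebra_simps power2_eq_square)
  have ev: "eigenvalue A k" if "m11 * p + m12 * q = k * p" "m21 * p + m22 * q = k * q" "p \<noteq> 0 \<or> q \<noteq> 0" for p q
    unfolding eigenvalue_def eigenvector_def
  proof (intro exI conjI)
    let ?v = "vec 2 (\<lambda>i. if i = 0 then p else q)"
    show "?v \<in> carrier_vec (dim_row A)" using A by auto
    show "?v \<noteq> 0\<^sub>v (dim_row A)"
    proof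
      assume "?v = 0\<^sub>v (dim_row A)"
      then have "?v $ 0 = 0" "?v $ 1 = 0" using A by auto
      then show False using that(3) by simp
    qed
    show "A *\<^sub>v ?v = k \<cdot>\<^sub>v ?v"
    proof
      show "dim_vec (A *\<^sub>v ?v) = dim_vec (k \<cdot>\<^sub>v ?v)" using A by simp
      fix i assume "i < dim_vec (k \<cdot>\<^sub>v ?v)"
      then have "i = 0 \<or> i = 1" by auto
      then show "(A *\<^sub>v ?v) $ i = (k \<cdot>\<^sub>v ?v) $ i"
        using A that(1,2) by (auto simp: scalar_prod_def numeral_2_eq_2 m11_def m12_def m21_def m22_def)
    qed
  qed
  show ?thesis
  proof (cases "m12 = 0 \<and> k = m11")
    case False
    with r show ?thesis by (intro ev[of m12 "k - m11"]) (auto simp: algebra_simps)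
  next
    case True
    show ?thesis
    proof (cases "m21 = 0 \<and> k = m22")
      case False
      with True show ?thesis by (intro ev[of "k - m22" m21]) (auto simp: algebra_simps)
    next
      case 2: True
      with True show ?thesis by (intro ev[of 1 0]) auto
    qed
  qed
qed

lemma hurwitz_observer_roots:
  fixes k :: complex
  assumes H: "hurwitz (A_mat a - L_mat L1 L2 * C_mat a b bX)"
    and root: "k\<^sup>2 - of_real ((- a - L1 * \<gamma>\<^sub>1 a b bX 1) + (- (L2 * \<gamma>\<^sub>2 a b bX 1))) * k +
      of_real ((- a - L1 * \<gamma>\<^sub>1 a b bX 1) * (- (L2 * \<gamma>\<^sub>2 a b bX 1)) -
        (1 - L1 * \<gamma>\<^sub>2 a b bX 1) * (- (L2 * \<gamma>\<^sub>1 a b bX 1))) = 0"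
  shows "Re k < 0"
proof -
  let ?M = "A_mat a - L_mat L1 L2 * C_mat a b bX"
  have dims: "A_mat a \<in> carrier_mat 2 2" "L_mat L1 L2 \<in> carrier_mat 2 1" "C_mat a b bX \<in> carrier_mat 1 2"
    by (auto simp: A_mat_def L_mat_def C_mat_def mat_of_rows_list_def)
  then have M: "?M \<in> carrier_mat 2 2" by auto
  have entries: "?M $$ (0,0) = - a - L1 * \<gamma>\<^sub>1 a b bX 1" "?M $$ (0,1) = 1 - L1 * \<gamma>\<^sub>2 a b bX 1"
    "?M $$ (1,0) = - (L2 * \<gamma>\<^sub>1 a b bX 1)" "?M $$ (1,1) = - (L2 * \<gamma>\<^sub>2 a b bX 1)"
    by (auto simp: A_mat_def L_mat_def C_mat_def mat_of_rows_list_def scalar_prod_def)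
  have "eigenvalue (map_mat complex_of_real ?M) k"
  proof (rule eigenvalue_2x2)
    show C: "map_mat complex_of_real ?M \<in> carrier_mat 2 2" using M by simp
    have e: "map_mat complex_of_real ?M $$ (i, j) = complex_of_real (?M $$ (i, j))" if "i < 2" "j < 2" for i j
      using M that by (intro index_map_mat) auto
    have l: "0 < (2::nat)" "1 < (2::nat)" by auto
    show "k\<^sup>2 - (map_mat complex_of_real ?M $$ (0,0) + map_mat complex_of_real ?M $$ (1,1)) * k +
       (map_mat complex_of_real ?M $$ (0,0) * map_mat complex_of_real ?M $$ (1,1) -
        map_mat complex_of_real ?M $$ (0,1) * map_mat complex_of_real ?M $$ (1,0)) = 0"
      using root unfolding e[OF l(1) l(1)] e[OF l(1) l(2)] e[OF l(2) l(1)] e[OF l(2) l(2)] entries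
      by (simp only: of_real_add of_real_diff of_real_mult)
  qed
  then show ?thesis using H by (auto simp: hurwitz_def)
qed

section \<open>Exponential decay of the observer error\<close>

text \<open>The profile \<open>z\<close> obeys the energy bound up to time \<open>\<tau>\<close> and vanishes afterwards, so \<open>exp (lam * \<tau>)\<close> converts that
  bound into decay at the rate of the planar system.  All constants come from the coefficients alone, hence
  serve all inputs, initial data and solutions at once.\<close>

theorem observer_error_decay:
  assumes a: "a > 0" and b: "b < 0" and H: "hurwitz (A_mat a - L_mat L1 L2 * C_mat a b bX)"
  shows "\<exists>\<kappa>>0. \<exists>lam>0. \<forall>Ue U u X V uh Xh Vh.
       plant_solution a b bX Ue U u X V \<longrightarrow>
       observer_solution a b bX Ue L1 L2 U u uh Xh Vh \<longrightarrow>
       (\<forall>t\<ge>0. \<Omega> u X V uh Xh Vh t \<le> \<kappa> * \<Omega> u X V uh Xh Vh 0 * exp (- lam * t))"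
proof -
  define c1 c2 where "c1 = \<gamma>\<^sub>1 a b bX 1" and "c2 = \<gamma>\<^sub>2 a b bX 1"
  define \<tau> where "\<tau> = - 1 / b"
  have \<tau>: "\<tau> > 0" "- b * \<tau> = 1" using b by (auto simp: \<tau>_def)
  have travelled: "- b * t \<ge> 1" if "t \<ge> \<tau>" for t
  proof -
    have "- b * \<tau> \<le> - b * t" using that b by (intro mult_left_mono) auto
    then show ?thesis using \<tau>(2) by linarith
  qed
  have ab: "a \<noteq> 0" "b \<noteq> 0" using a b by auto
  have "bounded (\<gamma>\<^sub>1 a b bX ` {0..1} \<union> \<gamma>\<^sub>2 a b bX ` {0..1})"
    by (intro bounded_Un[THEN iffD2] conjI compact_imp_bounded compact_continuous_image \<gamma>_continuous compact_Icc)
  then obtain B where "\<forall>z \<in> \<gamma>\<^sub>1 a b bX ` {0..1} \<union> \<gamma>\<^sub>2 a b bX ` {0..1}. \<bar>z\<bar> \<le> B"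
    by (auto simp: bounded_iff)
  then have B: "\<bar>\<gamma>\<^sub>1 a b bX x\<bar> \<le> B" "\<bar>\<gamma>\<^sub>2 a b bX x\<bar> \<le> B" if "x \<in> {0..1}" for x
    using that by blast+
  show ?thesis
  proof (rule forced_system_decay[of "- a - L1 * c1" "- (L2 * c2)" "1 - L1 * c2" "- (L2 * c1)" \<tau> "- L1" "- L2"])
    show "Re k < 0" if "k\<^sup>2 - complex_of_real (- a - L1 * c1 + - (L2 * c2)) * k +
        complex_of_real ((- a - L1 * c1) * - (L2 * c2) - (1 - L1 * c2) * - (L2 * c1)) = 0" for k
      using hurwitz_observer_roots[OF H] that unfolding c1_def c2_def by blast
    show "\<tau> > 0" by fact
    fix \<kappa> lam :: real
    assume \<kappa>: "\<kappa> > 0" and lam: "lam > 0"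
      and decay: "\<And>\<xi>1 \<xi>2 \<zeta> T. \<lbrakk>caratheodory_deriv \<xi>1 (\<lambda>t. (- a - L1 * c1) * \<xi>1 t + (1 - L1 * c2) * \<xi>2 t + - L1 * \<zeta> t);
         caratheodory_deriv \<xi>2 (\<lambda>t. - (L2 * c1) * \<xi>1 t + - (L2 * c2) * \<xi>2 t + - L2 * \<zeta> t); T \<ge> 0;
         set_borel_measurable borel {0..T} \<zeta>; set_integrable lborel {0..T} (\<lambda>t. (\<zeta> t)\<^sup>2);
         AE t in lborel. t \<in> {\<tau><..T} \<longrightarrow> \<zeta> t = 0\<rbrakk> \<Longrightarrow>
         (\<xi>1 T)\<^sup>2 + (\<xi>2 T)\<^sup>2 \<le> \<kappa> * exp (- lam * T) * ((\<xi>1 0)\<^sup>2 + (\<xi>2 0)\<^sup>2 + (LBINT t:{0..T}. (\<zeta> t)\<^sup>2))"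
    \<comment> \<open>\<open>D\<close> is the price of passing between \<open>w\<close> and \<open>z\<close>.\<close>
    define D where "D = 3 * (1 + B\<^sup>2)"
    have D: "D > 0" by (simp add: D_def add_pos_nonneg)
    define \<kappa>' where "\<kappa>' = 3 * exp (lam * \<tau>) * D + D * \<kappa> * (1 + \<tau> * D)"
    have \<kappa>': "\<kappa>' > 0"
      unfolding \<kappa>'_def using D \<kappa> \<tau> by (intro add_pos_pos mult_pos_pos) auto
    show ?thesis
    proof (intro exI conjI allI impI)
      fix Ue U u X V uh Xh Vh and T :: real
      assume plant: "plant_solution a b bX Ue U u X V"
        and obs: "observer_solution a b bX Ue L1 L2 U u uh Xh Vh" and T: "T \<ge> 0"
      define w y Xe Ve where "w x t = u x t - uh x t" and "y t = u 1 t - uh 1 t"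
        and "Xe t = X t - Xh t" and "Ve t = V t - Vh t" for x t
      define z \<zeta> where "z t x = w x t - (\<gamma>\<^sub>1 a b bX x * Xe t + \<gamma>\<^sub>2 a b bX x * Ve t)"
        and "\<zeta> t = y t - (c1 * Xe t + c2 * Ve t)" for t x
      have wu: "weak_transport b (\<lambda>x t. bX * X t) u"
        and wuh: "weak_transport b (\<lambda>x t. bX * Xh t + inj_gain a b bX L1 L2 x * (u 1 t - uh 1 t)) uh"
        and Xd: "\<And>t. t \<ge> 0 \<Longrightarrow> (X has_real_derivative (- a * X t + V t)) (at t within {0..})"
        and Vd: "\<And>t. t \<ge> 0 \<Longrightarrow> (V has_real_derivative 0) (at t within {0..})"
        and Xh: "caratheodory_deriv Xh (\<lambda>t. - a * Xh t + Vh t + L1 * (u 1 t - uh 1 t))"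
        and Vh: "caratheodory_deriv Vh (\<lambda>t. L2 * (u 1 t - uh 1 t))"
        using plant obs by (auto simp: plant_solution_def observer_solution_def)
      have ru: "transport_regular u" "transport_regular uh"
        using wu wuh by (auto simp: weak_transport_def)
      have c: "continuous_on {0..} X" "continuous_on {0..} V"
        by (rule DERIV_continuous_on[OF Xd] DERIV_continuous_on[OF Vd]; simp)+
      have X: "caratheodory_deriv X (\<lambda>t. - a * X t + V t)" and V: "caratheodory_deriv V (\<lambda>t. 0)"
        by (intro caratheodory_deriv_if_derivative Xd Vd continuous_intros c; assumption)+
      have Xe: "caratheodory_deriv Xe (\<lambda>t. - a * Xe t + Ve t - L1 * y t)"
        using caratheodory_deriv_diff[OF X Xh]
        by (simp add: Xe_def[abs_def] Ve_def y_def algebra_simps)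
      have Ve: "caratheodory_deriv Ve (\<lambda>t. - (L2 * y t))"
        using caratheodory_deriv_diff[OF V Vh] by (simp add: Ve_def[abs_def] y_def)
      note ec = caratheodory_deriv_continuous[OF Xe] caratheodory_deriv_continuous[OF Ve]
      have wL2: "L2_Icc 0 1 (\<lambda>x. w x t)" if "t \<ge> 0" for t
        unfolding w_def by (intro L2_Icc_diff profile_L2 ru that)
      have zL2: "L2_Icc 0 1 (z t)" if "t \<ge> 0" for t
        unfolding z_def by (intro L2_Icc_diff wL2 that L2_Icc_continuous continuous_intros \<gamma>_continuous)
      have yL2: "L2_Icc 0 t y" if "t \<ge> 0" for t
        unfolding y_def by (intro L2_Icc_diff trace_L2 ru that)
      have \<zeta>L2: "L2_Icc 0 t \<zeta>" if "t \<ge> 0" for t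
        unfolding \<zeta>_def by (intro L2_Icc_diff yL2 that L2_Icc_continuous continuous_intros ec)
      have \<zeta>m: "set_borel_measurable borel {0..t} \<zeta>" and \<zeta>i: "set_integrable lborel {0..t} (\<lambda>s. (\<zeta> s)\<^sup>2)" if "t \<ge> 0" for t
        using \<zeta>L2[OF that] by (auto simp: L2_Icc_def)
      have weak: "(LBINT x:{0..1}. z t x * g (x + b * t)) - (LBINT x:{0..1}. z 0 x * g x) =
          b * (LBINT s:{0..t}. \<zeta> s * g (1 + b * s))" if "C1_real g g'" "t \<ge> 0" for g g' t
        unfolding z_def \<zeta>_def c1_def c2_def
        by (rule backstepping_identity[OF Xe Ve L2_Icc_integrable[OF yL2] ab L2_Icc_integrable[OF wL2] L2_Icc_integrable[OF wL2]])
           (use that error_characteristic_identity[OF plant obs that] in \<open>simp_all add: w_def y_def Xe_def\<close>)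
      have energy: "(LBINT x:{0..1}. (z t x)\<^sup>2) - b * (LBINT s:{0..t}. (\<zeta> s)\<^sup>2) = (LBINT x:{0..1}. (z 0 x)\<^sup>2)"
        and gone: "- b * t \<ge> 1 \<Longrightarrow> (LBINT x:{0..1}. (z t x)\<^sup>2) = 0" if t: "t \<ge> 0" for t
        by (rule transport_energy[OF b t _ _ \<zeta>m \<zeta>i weak]; use t zL2 in \<open>simp add: L2_unit_iff\<close>)+
      define Z0 where "Z0 = (LBINT x:{0..1}. (z 0 x)\<^sup>2)"
      have nonneg: "0 \<le> (LBINT x:S. (f x)\<^sup>2)" for S and f :: "real \<Rightarrow> real"
        by (simp add: set_lebesgue_integral_def)
      \<comment> \<open>The energy balance at \<open>T\<close> and at \<open>\<tau>\<close> attributes the whole initial energy to the outflow, so nothing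
      flows out in between.\<close>
      have late: "AE t in lborel. t \<in> {\<tau><..T} \<longrightarrow> \<zeta> t = 0"
      proof (cases "T > \<tau>")
        case True
        have "0 \<le> \<tau>" using \<tau> by simp
        have "(LBINT x:{0..1}. (z T x)\<^sup>2) = 0" "(LBINT x:{0..1}. (z \<tau> x)\<^sup>2) = 0"
          using True \<tau> by (intro gone travelled T; simp)+
        then have "b * (LBINT s:{0..T}. (\<zeta> s)\<^sup>2) = b * (LBINT s:{0..\<tau>}. (\<zeta> s)\<^sup>2)"
          using energy[OF T] energy[OF \<open>0 \<le> \<tau>\<close>] by linarith
        then have "(LBINT s:{0..T}. (\<zeta> s)\<^sup>2) = (LBINT s:{0..\<tau>}. (\<zeta> s)\<^sup>2)"
          using b by simp
        then show ?thesis using True \<tau> by (intro transport_outflow_late \<zeta>i T) auto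
      qed auto
      have S: "(LBINT s:{0..T}. (\<zeta> s)\<^sup>2) \<le> \<tau> * Z0"
      proof -
        have "- b * (LBINT s:{0..T}. (\<zeta> s)\<^sup>2) \<le> Z0"
          using energy[OF T] nonneg[of "{0..1}" "z T"] by (simp add: Z0_def)
        then have "\<tau> * (- b * (LBINT s:{0..T}. (\<zeta> s)\<^sup>2)) \<le> \<tau> * Z0"
          using \<tau> by (intro mult_left_mono) auto
        then show ?thesis using \<tau>(2) by (simp add: mult.assoc[symmetric] mult.commute[of \<tau>])
      qed
      define n where "n t = (Xe t)\<^sup>2 + (Ve t)\<^sup>2" for t
      define E where "E t = (LBINT x:{0..1}. (w x t)\<^sup>2)" for t
      have \<Omega>: "\<Omega> u X V uh Xh Vh t = E t + n t" for t
        by (simp add: \<Omega>_def E_def n_def w_def Xe_def Ve_def)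
      have n0: "n t \<ge> 0" for t by (simp add: n_def)
      have E0: "E t \<ge> 0" for t by (simp add: E_def nonneg)
      have nT: "n T \<le> \<kappa> * exp (- lam * T) * (n 0 + \<tau> * Z0)"
      proof -
        have "n T \<le> \<kappa> * exp (- lam * T) * (n 0 + (LBINT t:{0..T}. (\<zeta> t)\<^sup>2))"
          unfolding n_def
        proof (rule decay[OF _ _ T \<zeta>m[OF T] \<zeta>i[OF T] late])
          show "caratheodory_deriv Xe (\<lambda>t. (- a - L1 * c1) * Xe t + (1 - L1 * c2) * Ve t + - L1 * \<zeta> t)"
            using Xe by (simp add: \<zeta>_def algebra_simps)
          show "caratheodory_deriv Ve (\<lambda>t. - (L2 * c1) * Xe t + - (L2 * c2) * Ve t + - L2 * \<zeta> t)"
            using Ve by (simp add: \<zeta>_def algebra_simps)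
        qed
        also have "\<dots> \<le> \<kappa> * exp (- lam * T) * (n 0 + \<tau> * Z0)"
          using S \<kappa> by (intro mult_left_mono add_left_mono) auto
        finally show ?thesis .
      qed
      have zT: "(LBINT x:{0..1}. (z T x)\<^sup>2) \<le> exp (lam * \<tau>) * exp (- lam * T) * Z0"
      proof (cases "T \<ge> \<tau>")
        case True
        then have "- b * T \<ge> 1" by (intro travelled) simp
        then show ?thesis using gone[OF T] nonneg by (simp add: Z0_def)
      next
        case False
        then have "lam * T \<le> lam * \<tau>" using lam by (intro mult_left_mono) auto
        then have "1 \<le> exp (lam * \<tau>) * exp (- lam * T)" by (simp add: exp_add[symmetric])
        then have "1 * Z0 \<le> exp (lam * \<tau>) * exp (- lam * T) * Z0"
          using nonneg[of "{0..1}" "z 0"] unfolding Z0_def by (intro mult_right_mono)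
        moreover have "(LBINT x:{0..1}. (z T x)\<^sup>2) \<le> Z0"
          using energy[OF T] mult_nonpos_nonneg[of b, OF _ nonneg[of "{0..T}" \<zeta>]] b by (simp add: Z0_def)
        ultimately show ?thesis by linarith
      qed
      have ET: "E T \<le> 3 * (LBINT x:{0..1}. (z T x)\<^sup>2) + 3 * B\<^sup>2 * n T"
        unfolding E_def n_def
        by (rule square_integral_backstepping_le[OF B zL2[OF T] wL2[OF T]]) (simp_all add: z_def algebra_simps)
      have zero: "(0::real) \<le> 0" by simp
      have "Z0 \<le> 3 * E 0 + 3 * B\<^sup>2 * ((- Xe 0)\<^sup>2 + (- Ve 0)\<^sup>2)"
        unfolding Z0_def E_def
        by (rule square_integral_backstepping_le[OF B wL2[OF zero] zL2[OF zero]]) (simp_all add: z_def)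
      also have "\<dots> \<le> D * (E 0 + n 0)"
        using E0[of 0] n0[of 0] mult_nonneg_nonneg[OF zero_le_power2[of B] E0[of 0]]
        by (simp add: D_def n_def algebra_simps)
      finally have Z: "Z0 \<le> D * (E 0 + n 0)" .
      have "E T + n T \<le> 3 * (exp (lam * \<tau>) * exp (- lam * T) * Z0) + D * n T"
        using ET zT n0[of T] by (simp add: D_def algebra_simps)
      also have "\<dots> \<le> 3 * (exp (lam * \<tau>) * exp (- lam * T) * (D * (E 0 + n 0))) +
          D * (\<kappa> * exp (- lam * T) * ((E 0 + n 0) + \<tau> * (D * (E 0 + n 0))))"
      proof (intro add_mono mult_left_mono Z)
        have "n 0 + \<tau> * Z0 \<le> (E 0 + n 0) + \<tau> * (D * (E 0 + n 0))"
          using E0[of 0] \<tau> Z by (intro add_mono mult_left_mono) auto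
        then have "\<kappa> * exp (- lam * T) * (n 0 + \<tau> * Z0) \<le> \<kappa> * exp (- lam * T) * ((E 0 + n 0) + \<tau> * (D * (E 0 + n 0)))"
          using \<kappa> by (intro mult_left_mono) auto
        with nT show "n T \<le> \<kappa> * exp (- lam * T) * ((E 0 + n 0) + \<tau> * (D * (E 0 + n 0)))"
          by (rule order_trans)
      qed (use D in auto)
      also have "\<dots> = \<kappa>' * (E 0 + n 0) * exp (- lam * T)"
        unfolding \<kappa>'_def by (simp only: algebra_simps)
      finally show "\<Omega> u X V uh Xh Vh T \<le> \<kappa>' * \<Omega> u X V uh Xh Vh 0 * exp (- lam * T)"
        unfolding \<Omega> .
    qed (use \<kappa>' lam in auto)
  qed
qed

theorem corollary1:
  fixes a b bX Ue L1 L2 :: real and U :: "real \<Rightarrow> real"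
  assumes "a > 0" and "b < 0" and "bX \<noteq> 0"
    and "hurwitz (A_mat a - L_mat L1 L2 * C_mat a b bX)"
  shows "\<forall>u0 uh0 :: real \<Rightarrow> real. \<forall>X0 Xh0 V0 Vh0 :: real. L2_unit u0 \<longrightarrow> L2_unit uh0 \<longrightarrow>
    (\<exists>\<kappa>>0. \<exists>lam>0. \<forall>u X V uh Xh Vh.
       plant_solution a b bX Ue U u X V \<longrightarrow>
       observer_solution a b bX Ue L1 L2 U u uh Xh Vh \<longrightarrow>
       initial_data u0 X0 V0 u X V \<longrightarrow>
       initial_data uh0 Xh0 Vh0 uh Xh Vh \<longrightarrow>
       (\<forall>t\<ge>0. \<Omega> u X V uh Xh Vh t \<le> \<kappa> * \<Omega> u X V uh Xh Vh 0 * exp (- lam * t)))"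
  using observer_error_decay[OF assms(1,2,4)] by meson

end
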